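(* Let $(M,\omega)$ be a compact connected quantizable Kähler manifold with very ample quantum line bundle $(L,h)$, $\pi:L\to M$ the projection. Let $x\in M$ and let $\Sigma_x$ be the polar divisor associated to $x$. Then $\Sigma_x$ is the reduced support of a divisor; more precisely, $$\Sigma_x=\mathrm{red}(e_q)\qquad\text{for every } q\in\pi^{-1}(x),\ q\neq0,$$ where $\mathrm{red}(e_q)$ is the reduced support of the divisor $(e_q)$ of the holomorphic section $e_q$, i.e. its zero set.
   Context: Quantum line bundle: a holomorphic line bundle $\pi:L\to M$ over the Kähler manifold $(M,\omega)$ with hermitian metric $h$ (conjugate linear in the first argument) whose Chern connection has curvature $F=-\mathrm{i}\,\omega$; locally $\omega=-\mathrm{i}\,\partial\bar\partial\log\hat h$. $M$ is quantizable if such a bundle exists. $L$ very ample means that a basis of global holomorphic sections of $L$ defines a holomorphic embedding of $M$ into projective space. Scalar product on the space $\Gamma_{hol}(M,L)$ of global holomorphic sections: $\langle\varphi,\psi\rangle=\int_M h(\varphi,\psi)\,\Omega$, where $\Omega=\frac{1}{n!}\omega^n$, $n=\dim_{\mathbb{C}}M$, is the (positive) Liouville volume form. Coherent vectors: let $L_0$ be the total space of $L$ minus the zero section. For $q\in L_0$ define a linear form $\hat q$ on $\Gamma_{hol}(M,L)$ by $s(\pi(q))=\hat q(s)\,q$. The coherent vector $e_q\in\Gamma_{hol}(M,L)$ is the unique section with $\langle e_q,s\rangle=\hat q(s)$ for all $s$. One has $e_{cq}=\bar c^{-1}e_q$ for $c\in\mathbb{C}^*$. Polar divisor: for $x\in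 M$ and $0\ne q\in\pi^{-1}(x)$, $\Sigma_x:=\{x'\in M\mid\langle e_q,e_{q'}\rangle=0 \text{ for } 0\ne q'\in\pi^{-1}(x')\}$; this does not depend on the choice of $q$ and $q'$. Divisor of a holomorphic section $s\not\equiv0$: $(s)=\sum_Y n_Y Y$, the sum over irreducible codimension-one subvarieties $Y$ of $M$, with $n_Y$ the vanishing order of $s$ along $Y$. Its reduced support is the zero set of $s$, forgetting multiplicities. *)

theory Defs
  imports "HOL-Analysis.Analysis"
begin

section \<open>Calculus on open subsets of \<open>\<complex>\<^sup>n\<close>\<close>

primrec Ck_on :: "nat \<Rightarrow> 'a::euclidean_space set \<Rightarrow> ('a \<Rightarrow> 'b::real_normed_vector) \<Rightarrow> bool" where
  "Ck_on 0 S f \<longleftrightarrow> continuous_on S f"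
| "Ck_on (Suc k) S f \<longleftrightarrow>
     (\<forall>x\<in>S. f differentiable (at x)) \<and>
     (\<forall>b\<in>Basis. Ck_on k S (\<lambda>x. frechet_derivative f (at x) b))"

definition smooth_on_open :: "'a::euclidean_space set \<Rightarrow> ('a \<Rightarrow> 'b::real_normed_vector) \<Rightarrow> bool" where
  "smooth_on_open S f \<longleftrightarrow> open S \<and> (\<forall>k. Ck_on k S f)"

definition holomorphic_Cn :: "(complex^'n) set \<Rightarrow> (complex^'n \<Rightarrow> complex) \<Rightarrow> bool" where
  "holomorphic_Cn S f \<longleftrightarrow>
     open S \<and>
     (\<forall>z\<in>S. \<exists>f'. (f has_derivative f') (at z) \<and> (\<forall>c v. f' (c *s v) = c * f' v))"

section \<open>Complex manifolds\<close>

text \<open>The manifold is a whole type of class \<open>t2_space\<close>, its dimension is \<open>CARD('n)\<close>.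
  Points of a chart domain are recovered from coordinates with \<open>inv_into U \<phi>\<close>.\<close>

type_synonym ('m, 'n) chart = "'m set \<times> ('m \<Rightarrow> complex^'n)"

definition holomorphic_atlas :: "('m::t2_space, 'n::finite) chart set \<Rightarrow> bool" where
  "holomorphic_atlas A \<longleftrightarrow>
     (\<Union>(U, \<phi>)\<in>A. U) = UNIV \<and>
     (\<forall>(U, \<phi>)\<in>A. open U \<and> open (\<phi> ` U) \<and> (\<exists>\<psi>. homeomorphism U (\<phi> ` U) \<phi> \<psi>)) \<and>
     (\<forall>(U, \<phi>)\<in>A. \<forall>(V, \<psi>)\<in>A. \<forall>i.
        holomorphic_Cn (\<phi> ` (U \<inter> V)) (\<lambda>z. \<psi> (inv_into U \<phi> z) $ i))"

definition holomorphic_fun_on ::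
  "('m::t2_space, 'n::finite) chart set \<Rightarrow> 'm set \<Rightarrow> ('m \<Rightarrow> complex) \<Rightarrow> bool" where
  "holomorphic_fun_on A S f \<longleftrightarrow>
     (\<forall>(U, \<phi>)\<in>A. holomorphic_Cn (\<phi> ` (U \<inter> S)) (\<lambda>z. f (inv_into U \<phi> z)))"

section \<open>Kaehler forms\<close>

text \<open>A real 2-form is given by its coordinate expressions: \<open>om (U, \<phi>) z v w\<close> is the value of
  the pulled back form at \<open>z \<in> \<phi> ` U\<close> on the constant vector fields \<open>v\<close>, \<open>w\<close>.
  Convention: \<open>(\<alpha> \<and> \<beta>)(v, w) = \<alpha>(v) \<beta>(w) - \<alpha>(w) \<beta>(v)\<close>.\<close>

type_synonym ('m, 'n) two_form =
  "('m, 'n) chart \<Rightarrow> complex^'n \<Rightarrow> complex^'n \<Rightarrow> complex^'n \<Rightarrow> real"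

definition smooth_two_form ::
  "('m::t2_space, 'n::finite) chart set \<Rightarrow> ('m, 'n) two_form \<Rightarrow> bool" where
  "smooth_two_form A om \<longleftrightarrow>
     (\<forall>(U, \<phi>)\<in>A. \<forall>z\<in>\<phi> ` U. bilinear (om (U, \<phi>) z) \<and> (\<forall>v. om (U, \<phi>) z v v = 0)) \<and>
     (\<forall>(U, \<phi>)\<in>A. \<forall>v w. smooth_on_open (\<phi> ` U) (\<lambda>z. om (U, \<phi>) z v w)) \<and>
     (\<forall>(U, \<phi>)\<in>A. \<forall>(V, \<psi>)\<in>A. \<forall>z\<in>\<phi> ` (U \<inter> V). \<forall>v w.
        let T = (\<lambda>y. \<psi> (inv_into U \<phi> y)); T' = frechet_derivative T (at z) in
        om (U, \<phi>) z v w = om (V, \<psi>) (T z) (T' v) (T' w))"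

definition closed_two_form ::
  "('m::t2_space, 'n::finite) chart set \<Rightarrow> ('m, 'n) two_form \<Rightarrow> bool" where
  "closed_two_form A om \<longleftrightarrow>
     (\<forall>(U, \<phi>)\<in>A. \<forall>z\<in>\<phi> ` U. \<forall>u v w.
        frechet_derivative (\<lambda>y. om (U, \<phi>) y v w) (at z) u
      + frechet_derivative (\<lambda>y. om (U, \<phi>) y w u) (at z) v
      + frechet_derivative (\<lambda>y. om (U, \<phi>) y u v) (at z) w = 0)"

text \<open>The last two conditions say that the form is of type \<open>(1,1)\<close> and that
  \<open>(v, w) \<mapsto> \<omega>(v, J w)\<close> is positive definite, \<open>J\<close> being multiplication by \<open>\<i>\<close>.\<close>

definition kaehler_form ::
  "('m::t2_space, 'n::finite) chart set \<Rightarrow> ('m, 'n) two_form \<Rightarrow> bool" where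
  "kaehler_form A om \<longleftrightarrow>
     smooth_two_form A om \<and> closed_two_form A om \<and>
     (\<forall>(U, \<phi>)\<in>A. \<forall>z\<in>\<phi> ` U. \<forall>v w. om (U, \<phi>) z (\<i> *s v) (\<i> *s w) = om (U, \<phi>) z v w) \<and>
     (\<forall>(U, \<phi>)\<in>A. \<forall>z\<in>\<phi> ` U. \<forall>v. v \<noteq> 0 \<longrightarrow> om (U, \<phi>) z v (\<i> *s v) > 0)"

text \<open>The positively oriented real basis \<open>\<partial>/\<partial>x\<^sub>j, \<partial>/\<partial>y\<^sub>j\<close>.\<close>

definition real_frame :: "'n::finite \<times> bool \<Rightarrow> complex^'n" where
  "real_frame = (\<lambda>(j, y). axis j (if y then \<i> else 1))"

text \<open>The coefficient of \<open>\<omega>\<^sup>n / n!\<close> with respect to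
  \<open>dx\<^sub>1 \<and> dy\<^sub>1 \<and> \<dots> \<and> dx\<^sub>n \<and> dy\<^sub>n\<close>, for one alternating form \<open>\<omega>\<close> on the tangent space.
  The \<open>n\<close>-fold wedge product is the signed sum over all permutations of the \<open>2n\<close> arguments
  divided by \<open>(2!)\<^sup>n\<close>.\<close>

definition liouville_density :: "(complex^'n::finite \<Rightarrow> complex^'n \<Rightarrow> real) \<Rightarrow> real" where
  "liouville_density \<omega> =
     (1 / fact CARD('n)) * (1 / 2 ^ CARD('n)) *
     (\<Sum>p | p permutes (UNIV :: ('n \<times> bool) set).
        of_int (sign p) *
        (\<Prod>j\<in>UNIV. \<omega> (real_frame (p (j, False))) (real_frame (p (j, True)))))"

text \<open>\<open>vol\<close> is the Borel measure of the volume form \<open>\<Omega> = \<omega>\<^sup>n / n!\<close>, so that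
  \<open>\<integral>\<^sub>M f \<Omega>\<close> is the integral of \<open>f\<close> with respect to \<open>vol\<close>. The condition determines \<open>vol\<close>.\<close>

definition liouville_measure ::
  "('m::t2_space, 'n::finite) chart set \<Rightarrow> ('m, 'n) two_form \<Rightarrow> 'm measure \<Rightarrow> bool" where
  "liouville_measure A om vol \<longleftrightarrow>
     sets vol = sets borel \<and>
     (\<forall>(U, \<phi>)\<in>A. \<forall>B\<in>sets borel. B \<subseteq> U \<longrightarrow>
        emeasure vol B =
          (\<integral>\<^sup>+z. ennreal (liouville_density (om (U, \<phi>) z)) * indicator (\<phi> ` B) z \<partial>lborel))"

section \<open>Holomorphic line bundles\<close>

text \<open>The type \<open>'l\<close> is the total space. An element \<open>(W, \<tau>)\<close> of \<open>triv\<close> stands for the local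
  trivialization \<open>q \<mapsto> (proj q, \<tau> q)\<close> over \<open>W\<close>. The vector space operations on \<open>'l\<close> are
  meaningful within fibres only.\<close>

record ('m, 'l) line_bundle =
  proj   :: "'l \<Rightarrow> 'm"
  fzero  :: "'m \<Rightarrow> 'l"
  fadd   :: "'l \<Rightarrow> 'l \<Rightarrow> 'l"
  fscale :: "complex \<Rightarrow> 'l \<Rightarrow> 'l"
  triv   :: "('m set \<times> ('l \<Rightarrow> complex)) set"

text \<open>Fibrewise linearity and bijectivity of the trivializations make every fibre a
  one-dimensional complex vector space.\<close>

definition holomorphic_line_bundle ::
  "('m::t2_space, 'n::finite) chart set \<Rightarrow> ('m, 'l::topological_space) line_bundle \<Rightarrow> bool" where
  "holomorphic_line_bundle A L \<longleftrightarrow>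
     continuous_on UNIV (proj L) \<and>
     (\<forall>p. proj L (fzero L p) = p) \<and>
     (\<forall>q q'. proj L q = proj L q' \<longrightarrow> proj L (fadd L q q') = proj L q) \<and>
     (\<forall>c q. proj L (fscale L c q) = proj L q) \<and>
     (\<Union>(W, \<tau>)\<in>triv L. W) = UNIV \<and>
     (\<forall>(W, \<tau>)\<in>triv L.
        open W \<and>
        (\<exists>g. homeomorphism (proj L -` W) (W \<times> UNIV) (\<lambda>q. (proj L q, \<tau> q)) g) \<and>
        (\<forall>p\<in>W. \<tau> (fzero L p) = 0) \<and>
        (\<forall>q q'. proj L q \<in> W \<and> proj L q = proj L q' \<longrightarrow> \<tau> (fadd L q q') = \<tau> q + \<tau> q') \<and>
        (\<forall>c q. proj L q \<in> W \<longrightarrow> \<tau> (fscale L c q) = c * \<tau> q)) \<and>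
     (\<forall>(W, \<tau>)\<in>triv L. \<forall>(W', \<tau>')\<in>triv L. \<exists>g.
        holomorphic_fun_on A (W \<inter> W') g \<and>
        (\<forall>p\<in>W \<inter> W'. g p \<noteq> 0) \<and>
        (\<forall>q. proj L q \<in> W \<inter> W' \<longrightarrow> \<tau>' q = g (proj L q) * \<tau> q))"

definition local_frame ::
  "('m, 'l) line_bundle \<Rightarrow> ('l \<Rightarrow> complex) \<Rightarrow> 'm \<Rightarrow> 'l" where
  "local_frame L \<tau> p = (THE q. proj L q = p \<and> \<tau> q = 1)"

text \<open>The local representing function \<open>h(\<sigma>, \<sigma>)\<close> of the metric in the coordinates \<open>\<phi>\<close>, where
  \<open>\<sigma>\<close> is the holomorphic frame with \<open>\<tau>(\<sigma>) = 1\<close>.\<close>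

definition local_metric ::
  "('m, 'l) line_bundle \<Rightarrow> ('l \<Rightarrow> 'l \<Rightarrow> complex) \<Rightarrow>
   ('m, 'n::finite) chart \<Rightarrow> 'm set \<times> ('l \<Rightarrow> complex) \<Rightarrow> complex^'n \<Rightarrow> real" where
  "local_metric L h = (\<lambda>(U, \<phi>) (W, \<tau>) z.
     (let s = local_frame L \<tau> (inv_into U \<phi> z) in Re (h s s)))"

definition hermitian_metric ::
  "('m::t2_space, 'n::finite) chart set \<Rightarrow> ('m, 'l::topological_space) line_bundle \<Rightarrow>
   ('l \<Rightarrow> 'l \<Rightarrow> complex) \<Rightarrow> bool" where
  "hermitian_metric A L h \<longleftrightarrow>
     (\<forall>q q1 q2. proj L q1 = proj L q \<and> proj L q2 = proj L q \<longrightarrow>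
        h q (fadd L q1 q2) = h q q1 + h q q2) \<and>
     (\<forall>q q' c. proj L q' = proj L q \<longrightarrow> h q (fscale L c q') = c * h q q') \<and>
     (\<forall>q q'. proj L q' = proj L q \<longrightarrow> h q' q = cnj (h q q')) \<and>
     (\<forall>q. q \<noteq> fzero L (proj L q) \<longrightarrow> Re (h q q) > 0) \<and>
     (\<forall>(U, \<phi>)\<in>A. \<forall>(W, \<tau>)\<in>triv L.
        smooth_on_open (\<phi> ` (U \<inter> W)) (local_metric L h (U, \<phi>) (W, \<tau>)))"

text \<open>In a holomorphic frame \<open>\<sigma>\<close> the Chern connection is \<open>d + \<theta>\<close>, where \<open>\<theta>\<close> is the
  \<open>(1,0)\<close>-part of the differential of \<open>log h(\<sigma>, \<sigma>)\<close>; here \<open>hh\<close> is \<open>h(\<sigma>, \<sigma>)\<close> in coordinates.\<close>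

definition chern_connection_form ::
  "(complex^'n::finite \<Rightarrow> real) \<Rightarrow> complex^'n \<Rightarrow> complex^'n \<Rightarrow> complex" where
  "chern_connection_form hh z v =
     (let D = frechet_derivative (\<lambda>y. ln (hh y)) (at z) in
      (of_real (D v) - \<i> * of_real (D (\<i> *s v))) / 2)"

text \<open>The curvature is \<open>F = d\<theta>\<close>, since \<open>\<theta> \<and> \<theta>\<close> vanishes in rank one.\<close>

definition chern_curvature ::
  "(complex^'n::finite \<Rightarrow> real) \<Rightarrow> complex^'n \<Rightarrow> complex^'n \<Rightarrow> complex^'n \<Rightarrow> complex" where
  "chern_curvature hh z v w =
     frechet_derivative (\<lambda>y. chern_connection_form hh y w) (at z) v
   - frechet_derivative (\<lambda>y. chern_connection_form hh y v) (at z) w"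

definition quantum_line_bundle ::
  "('m::t2_space, 'n::finite) chart set \<Rightarrow> ('m, 'n) two_form \<Rightarrow>
   ('m, 'l::topological_space) line_bundle \<Rightarrow> ('l \<Rightarrow> 'l \<Rightarrow> complex) \<Rightarrow> bool" where
  "quantum_line_bundle A om L h \<longleftrightarrow>
     holomorphic_line_bundle A L \<and> hermitian_metric A L h \<and>
     (\<forall>(U, \<phi>)\<in>A. \<forall>(W, \<tau>)\<in>triv L. \<forall>z\<in>\<phi> ` (U \<inter> W). \<forall>v w.
        chern_curvature (local_metric L h (U, \<phi>) (W, \<tau>)) z v w
          = - \<i> * of_real (om (U, \<phi>) z v w))"

section \<open>Global sections\<close>

definition hol_sections ::
  "('m::t2_space, 'n::finite) chart set \<Rightarrow> ('m, 'l::topological_space) line_bundle \<Rightarrow>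
   ('m \<Rightarrow> 'l) set" where
  "hol_sections A L =
     {s. (\<forall>p. proj L (s p) = p) \<and>
         (\<forall>(W, \<tau>)\<in>triv L. holomorphic_fun_on A W (\<lambda>p. \<tau> (s p)))}"

definition nonzero_vectors :: "('m, 'l) line_bundle \<Rightarrow> 'l set" where
  "nonzero_vectors L = {q. q \<noteq> fzero L (proj L q)}"

definition nonzero_section :: "('m, 'l) line_bundle \<Rightarrow> ('m \<Rightarrow> 'l) \<Rightarrow> bool" where
  "nonzero_section L s \<longleftrightarrow> (\<exists>p. s p \<noteq> fzero L p)"

definition hat :: "('m, 'l) line_bundle \<Rightarrow> 'l \<Rightarrow> ('m \<Rightarrow> 'l) \<Rightarrow> complex" where
  "hat L q s = (THE c. s (proj L q) = fscale L c q)"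

text \<open>\<open>B\<close> is a finite basis of the space of global holomorphic sections. The equation
  \<open>s = (\<Sum>t\<in>B. c t \<cdot> t)\<close> is written pointwise, in the frame \<open>q\<close> of each fibre.\<close>

definition section_basis ::
  "('m::t2_space, 'n::finite) chart set \<Rightarrow> ('m, 'l::topological_space) line_bundle \<Rightarrow>
   ('m \<Rightarrow> 'l) set \<Rightarrow> bool" where
  "section_basis A L B \<longleftrightarrow>
     finite B \<and> B \<subseteq> hol_sections A L \<and>
     (\<forall>c. (\<forall>q\<in>nonzero_vectors L. (\<Sum>t\<in>B. c t * hat L q t) = 0) \<longrightarrow> (\<forall>t\<in>B. c t = 0)) \<and>
     (\<forall>s\<in>hol_sections A L. \<exists>c. \<forall>q\<in>nonzero_vectors L. hat L q s = (\<Sum>t\<in>B. c t * hat L q t))"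

text \<open>The map \<open>p \<mapsto> [t(p)]\<^bsub>t\<in>B\<^esub>\<close> to projective space has, for any \<open>q \<noteq> 0\<close> over \<open>p\<close>,
  the homogeneous coordinates \<open>(hat L q t)\<^bsub>t\<in>B\<^esub>\<close>. It is a holomorphic embedding
  if it is well defined, injective and an immersion; it is then a homeomorphism onto its image
  by compactness of the manifold. The immersion condition is stated in the affine coordinates
  \<open>t / t\<^sub>0\<close>, \<open>t \<in> B\<close>, of the projective space: \<open>hat L (t\<^sub>0 p) t\<close> is the value at \<open>p\<close> of the
  quotient \<open>t / t\<^sub>0\<close>.\<close>

definition projective_embedding ::
  "('m::t2_space, 'n::finite) chart set \<Rightarrow> ('m, 'l::topological_space) line_bundle \<Rightarrow>
   ('m \<Rightarrow> 'l) set \<Rightarrow> bool" where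
  "projective_embedding A L B \<longleftrightarrow>
     (\<forall>p. \<exists>t\<in>B. t p \<noteq> fzero L p) \<and>
     (\<forall>q\<in>nonzero_vectors L. \<forall>q'\<in>nonzero_vectors L. \<forall>c.
        c \<noteq> 0 \<and> (\<forall>t\<in>B. hat L q' t = c * hat L q t) \<longrightarrow> proj L q = proj L q') \<and>
     (\<forall>(U, \<phi>)\<in>A. \<forall>p\<in>U. \<forall>t0\<in>B. t0 p \<noteq> fzero L p \<longrightarrow>
        (\<forall>v. v \<noteq> 0 \<longrightarrow>
          (\<exists>t\<in>B. frechet_derivative
                    (\<lambda>z. hat L (t0 (inv_into U \<phi> z)) t) (at (\<phi> p)) v \<noteq> 0)))"

definition very_ample ::
  "('m::t2_space, 'n::finite) chart set \<Rightarrow> ('m, 'l::topological_space) line_bundle \<Rightarrow> bool" where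
  "very_ample A L \<longleftrightarrow> (\<exists>B. section_basis A L B \<and> projective_embedding A L B)"

section \<open>Coherent vectors and polar divisors\<close>

definition section_inner ::
  "('l \<Rightarrow> 'l \<Rightarrow> complex) \<Rightarrow> 'm measure \<Rightarrow> ('m \<Rightarrow> 'l) \<Rightarrow> ('m \<Rightarrow> 'l) \<Rightarrow> complex" where
  "section_inner h vol s t = (LINT p|vol. h (s p) (t p))"

definition coherent_vector ::
  "('m::t2_space, 'n::finite) chart set \<Rightarrow> ('m, 'l::topological_space) line_bundle \<Rightarrow>
   ('l \<Rightarrow> 'l \<Rightarrow> complex) \<Rightarrow> 'm measure \<Rightarrow> 'l \<Rightarrow> 'm \<Rightarrow> 'l" where
  "coherent_vector A L h vol q =
     (THE e. e \<in> hol_sections A L \<and>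
             (\<forall>s\<in>hol_sections A L. section_inner h vol e s = hat L q s))"

text \<open>The condition does not depend on the nonzero vectors \<open>q\<close>, \<open>q'\<close> over \<open>x\<close>, \<open>x'\<close>.\<close>

definition polar_divisor ::
  "('m::t2_space, 'n::finite) chart set \<Rightarrow> ('m, 'l::topological_space) line_bundle \<Rightarrow>
   ('l \<Rightarrow> 'l \<Rightarrow> complex) \<Rightarrow> 'm measure \<Rightarrow> 'm \<Rightarrow> 'm set" where
  "polar_divisor A L h vol x =
     {x'. \<forall>q\<in>nonzero_vectors L. \<forall>q'\<in>nonzero_vectors L. proj L q = x \<and> proj L q' = x' \<longrightarrow>
        section_inner h vol (coherent_vector A L h vol q) (coherent_vector A L h vol q') = 0}"

text \<open>The reduced support \<open>red(s)\<close> of the divisor of a section \<open>s \<noteq> 0\<close>: its zero set,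
  forgetting the vanishing orders.\<close>

definition reduced_support :: "('m, 'l) line_bundle \<Rightarrow> ('m \<Rightarrow> 'l) \<Rightarrow> 'm set" where
  "reduced_support L s = {p. s p = fzero L p}"

end

theory Submission
  imports Defs
begin

text \<open>The Liouville density is positive: it is a Pfaffian, it transforms under a change of real frame
  by the determinant, it is positive on a symplectic basis, and it never vanishes along the segment
  from the flat form to the given one. So open sets have positive volume, and the scalar
  product on holomorphic sections is positive definite. On the finite-dimensional space of sections
  every linear form \<open>q\<close>-hat is then represented by a unique section \<open>e\<^sub>q\<close>, and
  \<open>\<langle>e\<^sub>q, e\<^sub>r\<rangle>\<close> is the conjugate of \<open>\<langle>e\<^sub>r, e\<^sub>q\<rangle> =\<close> \<open>r\<close>-hat \<open>(e\<^sub>q)\<close>, which vanishes exactly when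
  \<open>e\<^sub>q\<close> vanishes at the base point of \<open>r\<close>. Base-point freeness gives \<open>e\<^sub>q \<noteq> 0\<close>.\<close>

section \<open>Pfaffians\<close>

text \<open>The change of frame writes the Pfaffian of the standard pairing as \<open>det M\<close>
  times that of \<omega>. This yields nonvanishing only: the sign of \<open>det M\<close>, a real
  determinant of a complex frame, stays undetermined, and the segment to the flat form replaces that
  orientation computation. A second obstacle is that the data are local: \<open>vol\<close> is
  prescribed on Borel sets inside charts, the metric is smooth as a function of coordinates, and
  vectors can be added only within one fibre. So vectors are replaced by their coordinates in a
  trivialization, where \<open>hat\<close> is a quotient of two numbers and the metric is a product
  with a real factor. \<open>coherent_vector\<close> is a definite description, which says something
  only after existence and uniqueness of the representing section; existence comes from the linear
  system of the Gram matrix of a basis. \<open>polar_divisor\<close> quantifies over all nonzero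
  vectors of both fibres; reading one scalar product in either slot gives independence of these
  choices without a scaling rule for coherent vectors.\<close>

lemma permutes_UNIV_iff_inj:
  fixes f :: "'a::finite \<Rightarrow> 'a"
  shows "f permutes UNIV \<longleftrightarrow> inj f"
proof
  show "inj f" if "f permutes UNIV" using that by (rule permutes_inj)
  show "f permutes UNIV" if "inj f"
    using that finite_UNIV_inj_surj[OF finite that] by (intro bij_imp_permutes) (auto simp: bij_def)
qed

text \<open>This is \<open>n! 2\<^sup>n\<close> times the Pfaffian of an alternating matrix.\<close>

definition pairing_sum :: "('n::finite \<times> bool \<Rightarrow> 'n \<times> bool \<Rightarrow> real) \<Rightarrow> real" where
  "pairing_sum a = (\<Sum>p | p permutes UNIV.
     of_int (sign p) * (\<Prod>j\<in>UNIV. a (p (j, False)) (p (j, True))))"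

lemma liouville_density_pairing_sum:
  fixes \<omega> :: "complex^'n::finite \<Rightarrow> complex^'n \<Rightarrow> real"
  shows "liouville_density \<omega> = (1 / fact CARD('n)) * (1 / 2 ^ CARD('n)) *
    pairing_sum (\<lambda>i k. \<omega> (real_frame i) (real_frame k))"
  by (simp add: liouville_density_def pairing_sum_def)

lemma prod_times_bool:
  fixes f :: "'n::finite \<times> bool \<Rightarrow> 'a::comm_monoid_mult"
  shows "prod f UNIV = (\<Prod>j\<in>UNIV. f (j, False) * f (j, True))"
proof -
  have "prod f UNIV = prod f (UNIV \<times> UNIV)" by simp
  also have "\<dots> = (\<Prod>j\<in>UNIV. \<Prod>b\<in>UNIV. f (j, b))"
    by (simp only: prod.cartesian_product) (simp add: case_prod_unfold)
  finally show ?thesis by (simp add: UNIV_bool)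
qed

lemma sum_times_bool:
  fixes f :: "'n::finite \<times> bool \<Rightarrow> 'a::comm_monoid_add"
  shows "sum f UNIV = (\<Sum>j\<in>UNIV. f (j, False) + f (j, True))"
proof -
  have "sum f UNIV = sum f (UNIV \<times> UNIV)" by simp
  also have "\<dots> = (\<Sum>j\<in>UNIV. \<Sum>b\<in>UNIV. f (j, b))"
    by (simp only: sum.cartesian_product) (simp add: case_prod_unfold)
  finally show ?thesis by (simp add: UNIV_bool)
qed

lemma prod_double_sum:
  fixes F :: "'n::finite \<Rightarrow> 'i::finite \<Rightarrow> 'i \<Rightarrow> real"
  shows "(\<Prod>j\<in>UNIV. \<Sum>l\<in>UNIV. \<Sum>m\<in>UNIV. F j l m) =
    (\<Sum>f\<in>(UNIV :: ('n \<times> bool \<Rightarrow> 'i) set). \<Prod>j\<in>UNIV. F j (f (j, False)) (f (j, True)))"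
proof -
  have "(\<Prod>j\<in>UNIV. \<Sum>l\<in>UNIV. \<Sum>m\<in>UNIV. F j l m) =
      (\<Prod>j\<in>UNIV. \<Sum>lm\<in>(UNIV::('i\<times>'i) set). F j (fst lm) (snd lm))"
    by (simp only: sum.cartesian_product) (simp add: case_prod_unfold)
  also have "\<dots> = (\<Sum>g\<in>(UNIV :: ('n \<Rightarrow> 'i \<times> 'i) set). \<Prod>j\<in>UNIV. F j (fst (g j)) (snd (g j)))"
    by (subst prod_sum_PiE) (auto simp: PiE_def)
  also have "\<dots> = (\<Sum>f\<in>(UNIV :: ('n \<times> bool \<Rightarrow> 'i) set). \<Prod>j\<in>UNIV. F j (f (j, False)) (f (j, True)))"
    by (rule sum.reindex_bij_witness[where i = "\<lambda>f j. (f (j, False), f (j, True))"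
          and j = "\<lambda>g (j, b). if b then snd (g j) else fst (g j)"]) (auto simp: fun_eq_iff)
  finally show ?thesis .
qed

text \<open>Multilinear expansion gives a sum over all maps \<open>f\<close> from positions to
  indices. For fixed \<open>f\<close> the sum over \<open>p\<close> is a determinant of columns of
  \<open>M\<close> selected by \<open>f\<close>; it vanishes unless \<open>f\<close> is a
  permutation, and is then \<open>sign f * det M\<close>.\<close>

lemma pairing_sum_congruence:
  fixes M :: "real^('n::finite \<times> bool)^('n \<times> bool)"
  shows "pairing_sum (\<lambda>i k. \<Sum>l\<in>UNIV. \<Sum>m\<in>UNIV. M$i$l * M$k$m * a l m) = det M * pairing_sum a"
proof -
  let ?P = "{p. p permutes (UNIV :: ('n \<times> bool) set)}"
  let ?a = "\<lambda>f. \<Prod>j\<in>UNIV. a (f (j, False)) (f (j, True))"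
  \<comment> \<open>Row \<open>k\<close> of \<open>?N f\<close> is column \<open>f k\<close> of
    \<open>M\<close>, so a repeated value of \<open>f\<close> repeats a row.\<close>
  let ?N = "\<lambda>f. (\<chi> k. transpose M $ f k) :: real^('n \<times> bool)^('n \<times> bool)"
  have detN: "det (?N f) = (\<Sum>p\<in>?P. of_int (sign p) * (\<Prod>i\<in>UNIV. M $ p i $ f i))" for f
    by (simp add: det_def transpose_def)
  have detN_perm: "det (?N f) = of_int (sign f) * det M" if "f permutes UNIV" for f
    using det_permute_rows[OF that, of "transpose M"] by (simp add: det_transpose)
  have detN_0: "det (?N f) = 0" if f: "\<not> f permutes UNIV" for f
  proof -
    obtain i k where ik: "i \<noteq> k" "f i = f k"
      using f unfolding permutes_UNIV_iff_inj inj_def by blast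
    have "row i (?N f) = row k (?N f)"
      unfolding row_def using ik(2) by simp
    with ik(1) show ?thesis by (rule det_identical_rows)
  qed
  have "pairing_sum (\<lambda>i k. \<Sum>l\<in>UNIV. \<Sum>m\<in>UNIV. M$i$l * M$k$m * a l m) =
     (\<Sum>p\<in>?P. of_int (sign p) * (\<Sum>f\<in>UNIV. (\<Prod>i\<in>UNIV. M $ p i $ f i) * ?a f))"
    unfolding pairing_sum_def prod_double_sum prod.distrib prod_times_bool ..
  also have "\<dots> = (\<Sum>f\<in>UNIV. ?a f * det (?N f))"
    unfolding detN sum_distrib_left by (subst sum.swap) (simp only: mult_ac)
  also have "\<dots> = (\<Sum>f\<in>?P. ?a f * det (?N f))"
    by (rule sum.mono_neutral_right) (auto simp: detN_0)
  also have "\<dots> = (\<Sum>f\<in>?P. ?a f * (of_int (sign f) * det M))"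
    by (intro sum.cong) (auto simp: detN_perm)
  also have "\<dots> = det M * pairing_sum a"
    unfolding pairing_sum_def sum_distrib_left by (simp only: mult_ac)
  finally show ?thesis .
qed

section \<open>Signs of permutations that respect the pairs\<close>

definition pair_flip :: "'n set \<Rightarrow> 'n \<times> bool \<Rightarrow> 'n \<times> bool" where
  "pair_flip F = (\<lambda>(j, b). (j, b \<noteq> (j \<in> F)))"

lemma pair_flip_involution: "pair_flip F (pair_flip F x) = x"
  by (cases x) (auto simp: pair_flip_def)

lemma pair_flip_permutes: "pair_flip (F :: 'n::finite set) permutes UNIV"
  unfolding permutes_UNIV_iff_inj inj_def by (metis pair_flip_involution)

text \<open>The flip is a product of \<open>card F\<close> disjoint transpositions, one for each
  flipped pair.\<close>

lemma sign_pair_flip: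
  fixes F :: "'n::finite set"
  shows "sign (pair_flip F) = (-1) ^ card F"
proof -
  have "finite F" by simp
  then show ?thesis
  proof induction
    case empty
    have "pair_flip ({} :: 'n set) = id" by (auto simp: pair_flip_def)
    then show ?case by simp
  next
    case (insert j F)
    have "pair_flip (insert j F) = Transposition.transpose (j, False) (j, True) \<circ> pair_flip F"
      using insert.hyps by (auto simp: pair_flip_def Transposition.transpose_def fun_eq_iff)
    moreover have "permutation (pair_flip F)"
      using pair_flip_permutes permutation_permutes finite by blast
    ultimately show ?case
      using insert by (simp only: sign_compose permutation_swap_id) (simp add: sign_swap_id)
  qed
qed

text \<open>A transposition of two indices moves two pairs and so acts as two transpositions, whose
  signs cancel. Being a \<open>permutation\<close> is carried along because multiplicativity of the
  sign requires it.\<close>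

lemma sign_map_prod_id:
  fixes q :: "'n::finite \<Rightarrow> 'n"
  assumes "q permutes UNIV"
  shows "permutation (map_prod q (id :: bool \<Rightarrow> bool)) \<and> sign (map_prod q (id :: bool \<Rightarrow> bool)) = 1"
  using assms finite
proof (induction rule: permutes_induct)
  case id
  then show ?case by (simp add: map_prod.id)
next
  case (swap a b p)
  let ?t = "Transposition.transpose (a, False) (b, False) \<circ> Transposition.transpose (a, True) (b, True)"
  have *: "map_prod (Transposition.transpose a b \<circ> p) (id :: bool \<Rightarrow> bool) = ?t \<circ> map_prod p id"
    by (auto simp: Transposition.transpose_def fun_eq_iff)
  have "permutation ?t" "sign ?t = 1"
    by (auto simp: permutation_compose permutation_swap_id sign_compose sign_swap_id)
  then show ?case
    unfolding * using swap.IH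
    by (metis mult_1 permutation_compose sign_compose)
qed

text \<open>The matrix of the standard symplectic form in a Darboux basis.\<close>

definition standard_pairing :: "'n \<times> bool \<Rightarrow> 'n \<times> bool \<Rightarrow> real" where
  "standard_pairing = (\<lambda>(j, b) (k, c). if j \<noteq> k \<or> b = c then 0 else if c then 1 else -1)"

text \<open>Composing with the flip of the reversed pairs leaves a permutation of the indices alone,
  which is even. Hence the sign is the parity of the number of reversed pairs.\<close>

lemma sign_pair_preserving:
  fixes p :: "'n::finite \<times> bool \<Rightarrow> 'n \<times> bool"
  assumes p: "p permutes UNIV" and pres: "\<And>j. fst (p (j, False)) = fst (p (j, True))"
  shows "sign p = (\<Prod>j\<in>UNIV. if snd (p (j, False)) then -1 else 1)"
proof -
  define F where "F = {j. snd (p (j, False))}"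
  define q where "q j = fst (p (j, False))" for j
  have inj: "inj p" using p permutes_inj by blast
  have snd: "snd (p (j, True)) = (\<not> snd (p (j, False)))" for j
    using pres[of j] injD[OF inj, of "(j, True)" "(j, False)"] by (auto simp: prod_eq_iff)
  have comp: "p \<circ> pair_flip F = map_prod q id"
    using pres snd by (auto simp: fun_eq_iff pair_flip_def F_def q_def prod_eq_iff) (metis (full_types))+
  have "inj (p \<circ> pair_flip F)"
    using inj pair_flip_permutes permutes_inj inj_compose by blast
  then have "inj q" unfolding comp by (auto simp: inj_def)
  then have "q permutes UNIV"
    by (simp add: permutes_UNIV_iff_inj)
  then have "sign (map_prod q (id :: bool \<Rightarrow> bool)) = 1" using sign_map_prod_id by blast
  moreover have "permutation p" "permutation (pair_flip F)"
    using p pair_flip_permutes permutation_permutes finite by blast+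
  ultimately have "sign p * (-1) ^ card F = 1"
    using sign_compose[of p "pair_flip F"] sign_pair_flip[of F] by (simp add: comp)
  then have "sign p = (-1) ^ card F"
    by (metis (no_types) minus_one_power_iff mult_cancel_left1 mult_minus_right mult.right_neutral equation_minus_iff)
  also have "\<dots> = (\<Prod>j\<in>UNIV. if snd (p (j, False)) then -1 else 1)"
    by (simp add: prod.If_cases F_def)
  finally show ?thesis .
qed

text \<open>No cancellation occurs: a permutation that breaks a pair contributes a zero factor, and
  for the others the sign equals the product of the pairing values, so the term is 1. The identity
  ensures strict positivity.\<close>

lemma pairing_sum_standard_pos: "pairing_sum (standard_pairing :: 'n::finite \<times> bool \<Rightarrow> _) > 0"
proof -
  let ?t = "\<lambda>p. of_int (sign p) * (\<Prod>j\<in>UNIV. standard_pairing (p (j :: 'n, False)) (p (j, True)))"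
  have "?t p \<ge> 0" if p: "p permutes UNIV" for p
  proof (cases "\<forall>j. fst (p (j, False)) = fst (p (j, True))")
    case True
    have "inj p" using p permutes_inj by blast
    then have "snd (p (j, True)) = (\<not> snd (p (j, False)))" for j
      using True injD[of p "(j, True)" "(j, False)"] by (auto simp: prod_eq_iff)
    then have "standard_pairing (p (j, False)) (p (j, True)) = (if snd (p (j, False)) then -1 else 1)" for j
      using True by (auto simp: standard_pairing_def case_prod_unfold)
    then show ?thesis
      using sign_pair_preserving[OF p] True by (simp flip: prod.distrib) (auto intro: prod_nonneg)
  next
    case False
    then obtain j where "fst (p (j, False)) \<noteq> fst (p (j, True))" by blast
    then have "standard_pairing (p (j, False)) (p (j, True)) = 0"
      by (auto simp: standard_pairing_def case_prod_unfold)
    then have "(\<Prod>j\<in>UNIV. standard_pairing (p (j, False)) (p (j, True))) = 0"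
      by (intro prod_zero) auto
    then show ?thesis by (simp only:)
  qed
  moreover have "?t id > 0" by (simp add: standard_pairing_def)
  moreover have "id permutes UNIV" by (simp add: permutes_id)
  ultimately show ?thesis
    unfolding pairing_sum_def by (intro sum_pos2[where i = id]) auto
qed

section \<open>Positivity of the Liouville density\<close>

text \<open>The pointwise part of \<open>kaehler_form\<close>, isolated so that the linear algebra
  takes place in a single tangent space.\<close>

definition positive_11_form :: "(complex^'n::finite \<Rightarrow> complex^'n \<Rightarrow> real) \<Rightarrow> bool" where
  "positive_11_form \<omega> \<longleftrightarrow> bilinear \<omega> \<and> (\<forall>v. \<omega> v v = 0) \<and>
     (\<forall>v w. \<omega> (\<i> *s v) (\<i> *s w) = \<omega> v w) \<and> (\<forall>v. v \<noteq> 0 \<longrightarrow> \<omega> v (\<i> *s v) > 0)"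

lemma complex_scale: "c *s v = Re c *\<^sub>R v + Im c *\<^sub>R (\<i> *s (v :: complex^'n))"
  by (simp add: vec_eq_iff complex_eq_iff)

lemma antisymmetric_of_alternating:
  assumes "bilinear \<omega>" "\<And>v. \<omega> v v = (0::real)"
  shows "\<omega> v w = - \<omega> w v"
proof -
  have "\<omega> (v + w) (v + w) = \<omega> v w + \<omega> w v"
    unfolding bilinear_ladd[OF assms(1)] bilinear_radd[OF assms(1)] by (simp add: assms(2))
  then show ?thesis using assms(2)[of "v + w"] by simp
qed

text \<open>Lists a complex frame as a real one; \<open>real_frame\<close> is the case of the unit
  vectors.\<close>

definition J_frame :: "('n \<Rightarrow> complex^'n) \<Rightarrow> 'n \<times> bool \<Rightarrow> complex^'n" where
  "J_frame u = (\<lambda>(j, b). if b then \<i> *s u j else u j)"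

text \<open>Gram-Schmidt for the hermitian form with real part \<open>\<omega> v (\<i> *s w)\<close>
  and imaginary part \<open>\<omega> v w\<close>. The two conditions are the imaginary and the real
  part of orthonormality.\<close>

lemma positive_11_form_orthonormal_sequence:
  fixes \<omega> :: "complex^'n::finite \<Rightarrow> complex^'n \<Rightarrow> real"
  assumes pos: "positive_11_form \<omega>" and "k \<le> CARD('n)"
  shows "\<exists>u :: nat \<Rightarrow> complex^'n. \<forall>i<k. \<forall>j<k.
           \<omega> (u i) (u j) = 0 \<and> \<omega> (u i) (\<i> *s u j) = (if i = j then 1 else 0)"
  using assms(2)
proof (induction k)
  case 0
  then show ?case by simp
next
  case (Suc k)
  have bil: "bilinear \<omega>" and alt: "\<And>v. \<omega> v v = 0"
    and J: "\<And>v w. \<omega> (\<i> *s v) (\<i> *s w) = \<omega> v w"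
    and p: "\<And>v. v \<noteq> 0 \<Longrightarrow> \<omega> v (\<i> *s v) > 0"
    using pos by (auto simp: positive_11_form_def)
  note bs = bilinear_ladd[OF bil] bilinear_radd[OF bil] bilinear_lsub[OF bil] bilinear_rsub[OF bil]
    bilinear_lmul[OF bil] bilinear_rmul[OF bil] bilinear_rneg[OF bil] bilinear_lneg[OF bil]
  have linr: "linear (\<omega> v)" for v using bil by (simp add: bilinear_def)
  have anti: "\<omega> v w = - \<omega> w v" for v w using antisymmetric_of_alternating[OF bil alt] .
  have Jr: "\<omega> (\<i> *s v) w = - \<omega> v (\<i> *s w)" for v w
    using J[of v "\<i> *s w"] by (simp add: vector_smult_assoc bs flip: vector_sneg_minus1)
  obtain u :: "nat \<Rightarrow> complex^'n" where u: "\<And>i j. i < k \<Longrightarrow> j < k \<Longrightarrow> \<omega> (u i) (u j) = 0"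
    "\<And>i j. i < k \<Longrightarrow> j < k \<Longrightarrow> \<omega> (u i) (\<i> *s u j) = (if i = j then 1 else 0)"
    using Suc by auto
  \<comment> \<open>Fewer than \<open>CARD('n)\<close> vectors cannot span the space over the
    complex numbers, so a vector outside their complex span exists.\<close>
  have "vec.dim (vec.span (u ` {..<k})) \<le> card (u ` {..<k})"
    by (simp add: vec.dim_le_card')
  also have "\<dots> < CARD('n)" using card_image_le[of "{..<k}" u] Suc.prems by simp
  finally have "vec.span (u ` {..<k}) \<noteq> UNIV"
    using vec_dim_card[where 'a = complex and 'n = 'n] by (metis less_irrefl)
  then obtain w where w: "w \<notin> vec.span (u ` {..<k})" by blast
  \<comment> \<open>The hermitian product of \<open>u i\<close> with \<open>w\<close>, complex
    linear in \<open>w\<close>; subtracting these multiples leaves the orthogonal component.\<close>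
  define c where "c i = Complex (\<omega> (u i) (\<i> *s w)) (\<omega> (u i) w)" for i
  define v where "v = w - (\<Sum>i<k. c i *s u i)"
  have "(\<Sum>i<k. c i *s u i) \<in> vec.span (u ` {..<k})"
    by (intro vec.span_sum vec.span_scale vec.span_base) auto
  with w have "v \<noteq> 0" unfolding v_def by auto
  have ov: "\<omega> (u i) v = 0" "\<omega> (u i) (\<i> *s v) = 0" if "i < k" for i
  proof -
    have 1: "\<omega> (u i) (c j *s u j) = (if i = j then Im (c j) else 0)" if "j < k" for j
      using u \<open>i < k\<close> that by (subst complex_scale) (simp add: bs)
    have 2: "\<omega> (u i) (\<i> *s (c j *s u j)) = (if i = j then Re (c j) else 0)" if "j < k" for j
      using u \<open>i < k\<close> that
      by (simp only: vector_smult_assoc, subst complex_scale) (simp add: bs)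
    have "\<omega> (u i) v = \<omega> (u i) w - (\<Sum>j<k. if i = j then Im (c j) else 0)"
      unfolding v_def using 1 by (simp add: bs linear_sum[OF linr])
    then show "\<omega> (u i) v = 0" using that by (simp add: c_def)
    have "\<i> *s v = \<i> *s w - (\<Sum>j<k. \<i> *s (c j *s u j))"
      unfolding v_def by (simp add: vec.scale_right_diff_distrib vec.scale_sum_right)
    then have "\<omega> (u i) (\<i> *s v) = \<omega> (u i) (\<i> *s w) - (\<Sum>j<k. if i = j then Re (c j) else 0)"
      using 2 by (simp add: bs linear_sum[OF linr])
    then show "\<omega> (u i) (\<i> *s v) = 0" using that by (simp add: c_def)
  qed
  define r where "r = 1 / sqrt (\<omega> v (\<i> *s v))"
  define u' where "u' = u(k := r *\<^sub>R v)"
  have irv: "\<i> *s (r *\<^sub>R v) = r *\<^sub>R (\<i> *s v)"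
    by (simp add: vec_eq_iff)
  have norm_v: "r * (r * \<omega> v (\<i> *s v)) = 1"
    using p[OF \<open>v \<noteq> 0\<close>] by (simp add: r_def)
  have vo: "\<omega> v (u i) = 0" "\<omega> v (\<i> *s u i) = 0" if "i < k" for i
    unfolding anti[of v "u i"] anti[of v "\<i> *s u i"] Jr[of "u i" v] ov[OF that] by simp_all
  have "\<omega> (u' i) (u' j) = 0 \<and> \<omega> (u' i) (\<i> *s u' j) = (if i = j then 1 else 0)"
    if ij: "i < Suc k" "j < Suc k" for i j
  proof -
    consider "i < k" "j < k" | "i < k" "j = k" | "i = k" "j < k" | "i = k" "j = k"
      using ij by linarith
    then show ?thesis
      by cases (simp_all add: u'_def irv bs u ov vo alt norm_v)
  qed
  then show ?case by blast
qed

lemma positive_11_form_symplectic_basis: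
  fixes \<omega> :: "complex^'n::finite \<Rightarrow> complex^'n \<Rightarrow> real"
  assumes pos: "positive_11_form \<omega>"
  obtains u where "\<And>i k. \<omega> (J_frame u i) (J_frame u k) = standard_pairing i k"
proof -
  have bil: "bilinear \<omega>" and alt: "\<And>v. \<omega> v v = 0"
    and J: "\<And>v w. \<omega> (\<i> *s v) (\<i> *s w) = \<omega> v w"
    using pos by (auto simp: positive_11_form_def)
  have anti: "\<omega> v w = - \<omega> w v" for v w using antisymmetric_of_alternating[OF bil alt] .
  obtain f :: "'n \<Rightarrow> nat" where f: "bij_betw f UNIV {0..<CARD('n)}"
    using ex_bij_betw_finite_nat[OF finite] by blast
  obtain u :: "nat \<Rightarrow> complex^'n" where
    u: "\<And>i j. i < CARD('n) \<Longrightarrow> j < CARD('n) \<Longrightarrow> \<omega> (u i) (u j) = 0"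
    "\<And>i j. i < CARD('n) \<Longrightarrow> j < CARD('n) \<Longrightarrow> \<omega> (u i) (\<i> *s u j) = (if i = j then 1 else 0)"
    using positive_11_form_orthonormal_sequence[OF pos order_refl] by blast
  have f_less: "f j < CARD('n)" for j using bij_betwE[OF f] by auto
  have f_inj: "f i = f j \<longleftrightarrow> i = j" for i j
    using bij_betw_imp_inj_on[OF f] by (auto simp: inj_def)
  have "\<omega> (J_frame (u \<circ> f) i) (J_frame (u \<circ> f) k) = standard_pairing i k" for i k
    using u f_less f_inj anti[of "\<i> *s u (f (fst i))" "u (f (fst k))"]
    by (auto simp: J_frame_def standard_pairing_def J split: prod.splits)
  then show ?thesis by (rule that)
qed

section \<open>Change of frame and comparison with the flat form\<close>

lemma real_frame_expansion:
  fixes v :: "complex^'n::finite"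
  shows "v = (\<Sum>l\<in>UNIV. (if snd l then Im (v $ fst l) else Re (v $ fst l)) *\<^sub>R real_frame l)"
proof -
  have "(\<Sum>l\<in>UNIV. (if snd l then Im (v $ fst l) else Re (v $ fst l)) *\<^sub>R real_frame l) $ i = v $ i" for i
    by (simp add: sum_times_bool real_frame_def axis_def complex_eq_iff if_distrib
        cong: if_cong)
  then show ?thesis by (simp add: vec_eq_iff)
qed

text \<open>If the rows of \<open>M\<close> are the real coordinates of a symplectic basis,
  congruence by \<open>M\<close> carries \<omega> to the standard pairing. Its positive pairing sum
  is \<open>det M\<close> times the one in question, so neither factor is zero.\<close>

lemma pairing_sum_nonzero:
  fixes \<omega> :: "complex^'n::finite \<Rightarrow> complex^'n \<Rightarrow> real"
  assumes pos: "positive_11_form \<omega>"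
  shows "pairing_sum (\<lambda>i k. \<omega> (real_frame i) (real_frame k)) \<noteq> 0"
proof -
  obtain u where u: "\<And>i k. \<omega> (J_frame u i) (J_frame u k) = standard_pairing i k"
    using positive_11_form_symplectic_basis[OF pos] by blast
  have bil: "bilinear \<omega>" using pos by (auto simp: positive_11_form_def)
  have lin: "linear (\<omega> v)" "linear (\<lambda>v. \<omega> v w)" for v w using bil by (auto simp: bilinear_def)
  define M :: "real^('n \<times> bool)^('n \<times> bool)" where
    "M = (\<chi> i l. if snd l then Im (J_frame u i $ fst l) else Re (J_frame u i $ fst l))"
  have exp: "J_frame u i = (\<Sum>l\<in>UNIV. M $ i $ l *\<^sub>R real_frame l)" for i
    unfolding M_def by (subst real_frame_expansion) simp
  have "standard_pairing i k = (\<Sum>l\<in>UNIV. \<Sum>m\<in>UNIV. M$i$l * M$k$m * \<omega> (real_frame l) (real_frame m))" for i k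
    unfolding u[symmetric] exp
    by (simp add: linear_sum[OF lin(1)] linear_sum[OF lin(2)] linear_cmul[OF lin(1)] linear_cmul[OF lin(2)]
        sum_distrib_left mult_ac) (rule sum.swap)
  then have "pairing_sum (standard_pairing :: 'n \<times> bool \<Rightarrow> _) =
      pairing_sum (\<lambda>i k. \<Sum>l\<in>UNIV. \<Sum>m\<in>UNIV. M$i$l * M$k$m * \<omega> (real_frame l) (real_frame m))"
    by presburger
  then show ?thesis
    using pairing_sum_standard_pos[where 'n = 'n] unfolding pairing_sum_congruence by auto
qed

text \<open>The standard Kaehler form, the sum of \<open>dx\<^sub>j \<and> dy\<^sub>j\<close>; its
  metric is the Euclidean one.\<close>

definition flat_form :: "complex^'n::finite \<Rightarrow> complex^'n \<Rightarrow> real" where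
  "flat_form v w = (\<i> *s v) \<bullet> w"

lemma bilinear_flat_form: "bilinear flat_form"
  unfolding bilinear_def flat_form_def
  by (auto intro!: linearI simp: inner_simps vec.scale_right_distrib)
     (simp add: inner_vec_def inner_complex_def sum_distrib_left algebra_simps)

lemma positive_11_form_flat_form: "positive_11_form (flat_form :: complex^'n::finite \<Rightarrow> _)"
proof -
  have "flat_form v (\<i> *s v) > 0" if "v \<noteq> 0" for v :: "complex^'n"
  proof -
    have "\<i> *s v \<noteq> 0" using that by simp
    then show ?thesis unfolding flat_form_def by (simp only: inner_gt_zero_iff not_False_eq_True)
  qed
  moreover have "flat_form v v = 0" "flat_form (\<i> *s v) (\<i> *s w) = flat_form v w" for v w :: "complex^'n"
    by (auto simp: flat_form_def inner_vec_def inner_complex_def algebra_simps)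
  ultimately show ?thesis
    by (simp add: positive_11_form_def bilinear_flat_form)
qed

lemma flat_form_real_frame:
  fixes i k :: "'n::finite \<times> bool"
  shows "flat_form (real_frame i) (real_frame k) = standard_pairing i k"
proof -
  have "\<i> *s axis j x = axis j (\<i> * x)" for j :: 'n and x
    by (simp add: vec_eq_iff axis_def)
  then show ?thesis
    by (cases i; cases k)
      (simp add: real_frame_def flat_form_def standard_pairing_def inner_axis_axis inner_complex_def)
qed

text \<open>The pairing sum has no zero on the convex set of positive \<open>(1,1)\<close>-forms, so it keeps the sign
  that it has at the flat form.\<close>

lemma liouville_density_pos:
  fixes \<omega> :: "complex^'n::finite \<Rightarrow> complex^'n \<Rightarrow> real"
  assumes pos: "positive_11_form \<omega>"
  shows "liouville_density \<omega> > 0"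
proof -
  define \<omega>t where "\<omega>t t v w = (1 - t) * flat_form v w + t * \<omega> v w" for t v w
  define P where "P t = pairing_sum (\<lambda>i k. \<omega>t t (real_frame i) (real_frame k))" for t
  have form: "positive_11_form (\<omega>t t)" if "0 \<le> t" "t \<le> 1" for t
  proof -
    have "\<omega>t t v (\<i> *s v) > 0" if v: "v \<noteq> 0" for v
    proof -
      have "\<omega> v (\<i> *s v) > 0" "flat_form v (\<i> *s v) > 0"
        using v pos positive_11_form_flat_form unfolding positive_11_form_def by blast+
      then show ?thesis
        \<comment> \<open>A convex combination of two positive numbers is positive; the signs are
          reversed to fit an upper bound by 0.\<close>
        using convex_bound_lt[of "- \<omega> v (\<i> *s v)" 0 "- flat_form v (\<i> *s v)" t "1 - t"] that \<open>0 \<le> t\<close> \<open>t \<le> 1\<close>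
        by (simp add: \<omega>t_def)
    qed
    moreover have "bilinear (\<omega>t t)"
    proof -
      have b: "bilinear \<omega>" using pos by (simp add: positive_11_form_def)
      note bilinear_simps = bilinear_ladd bilinear_radd bilinear_lmul bilinear_rmul
      show ?thesis
        unfolding bilinear_def
        by (intro conjI allI linearI)
          (simp_all add: \<omega>t_def bilinear_simps[OF b] bilinear_simps[OF bilinear_flat_form] algebra_simps)
    qed
    ultimately show ?thesis
      using pos positive_11_form_flat_form by (auto simp: \<omega>t_def positive_11_form_def)
  qed
  have P0: "P 0 > 0"
    using pairing_sum_standard_pos by (simp add: P_def \<omega>t_def flat_form_real_frame)
  have "continuous_on {0..1} P"
    unfolding P_def pairing_sum_def \<omega>t_def by (intro continuous_intros)
  then have "\<exists>t\<ge>0. t \<le> 1 \<and> P t = 0" if "P 1 \<le> 0"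
    using IVT2'[of P 1 0 0] that P0 by auto
  then have "P 1 > 0"
    using pairing_sum_nonzero[OF form] unfolding P_def by (meson not_le)
  then show ?thesis
    by (simp add: liouville_density_pairing_sum P_def \<omega>t_def)
qed

section \<open>Holomorphic functions and the Liouville measure\<close>

lemma holomorphic_Cn_const: "open S \<Longrightarrow> holomorphic_Cn S (\<lambda>z. c)"
  unfolding holomorphic_Cn_def by (auto intro!: exI[of _ "\<lambda>v. 0"] derivative_eq_intros)

lemma holomorphic_Cn_add:
  assumes "holomorphic_Cn S f" "holomorphic_Cn S g"
  shows "holomorphic_Cn S (\<lambda>z. f z + g z)"
  unfolding holomorphic_Cn_def
proof (intro conjI ballI)
  show "open S" using assms by (simp add: holomorphic_Cn_def)
  fix z assume "z \<in> S"
  then obtain f' g' where "(f has_derivative f') (at z)" "\<forall>c v. f' (c *s v) = c * f' v"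
    "(g has_derivative g') (at z)" "\<forall>c v. g' (c *s v) = c * g' v"
    using assms unfolding holomorphic_Cn_def by meson
  then show "\<exists>f'. ((\<lambda>z. f z + g z) has_derivative f') (at z) \<and> (\<forall>c v. f' (c *s v) = c * f' v)"
    by (intro exI[of _ "\<lambda>v. f' v + g' v"]) (auto intro: has_derivative_add simp: algebra_simps)
qed

lemma holomorphic_Cn_cmult:
  assumes "holomorphic_Cn S f"
  shows "holomorphic_Cn S (\<lambda>z. a * f z)"
  unfolding holomorphic_Cn_def
proof (intro conjI ballI)
  show "open S" using assms by (simp add: holomorphic_Cn_def)
  fix z assume "z \<in> S"
  then obtain f' where "(f has_derivative f') (at z)" "\<forall>c v. f' (c *s v) = c * f' v"
    using assms unfolding holomorphic_Cn_def by meson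
  then show "\<exists>f'. ((\<lambda>z. a * f z) has_derivative f') (at z) \<and> (\<forall>c v. f' (c *s v) = c * f' v)"
    by (intro exI[of _ "\<lambda>v. a * f' v"]) (auto intro: has_derivative_mult_right)
qed

lemma holomorphic_Cn_sum:
  assumes "open S" "\<And>t. t \<in> B \<Longrightarrow> holomorphic_Cn S (f t)"
  shows "holomorphic_Cn S (\<lambda>z. \<Sum>t\<in>B. f t z)"
  using assms(2)
proof (induction B rule: infinite_finite_induct)
  case (insert t B)
  have "holomorphic_Cn S (f t)" "holomorphic_Cn S (\<lambda>z. \<Sum>t\<in>B. f t z)"
    using insert by auto
  then show ?case using insert.hyps by (simp add: holomorphic_Cn_add)
qed (simp_all add: holomorphic_Cn_const[OF assms(1)])

lemma holomorphic_Cn_cong: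
  assumes "holomorphic_Cn S f" "\<And>z. z \<in> S \<Longrightarrow> f z = g z"
  shows "holomorphic_Cn S g"
  using assms unfolding holomorphic_Cn_def
  by (meson has_derivative_transform_within_open)

lemma holomorphic_Cn_imp_continuous_on: "holomorphic_Cn S f \<Longrightarrow> continuous_on S f"
  unfolding holomorphic_Cn_def
  by (metis continuous_at_imp_continuous_on has_derivative_continuous)

section \<open>Charts and passage between coordinates and points\<close>

locale holomorphic_manifold =
  fixes A :: "('m::t2_space, 'n::finite) chart set"
  assumes atlas: "holomorphic_atlas A"
begin

lemma chart_at:
  obtains U \<phi> where "(U, \<phi>) \<in> A" "p \<in> U"
proof -
  have "(\<Union>(U, \<phi>)\<in>A. U) = UNIV"
    using atlas unfolding holomorphic_atlas_def by (elim conjE)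
  then have "p \<in> (\<Union>(U, \<phi>)\<in>A. U)" by simp
  then show ?thesis using that by blast
qed

context
  fixes U :: "'m set" and \<phi> :: "'m \<Rightarrow> complex^'n"
  assumes chart: "(U, \<phi>) \<in> A"
begin

lemma open_chart_domain: "open U"
  and open_chart_image: "open (\<phi> ` U)"
  and chart_homeomorphism: "\<exists>\<psi>. homeomorphism U (\<phi> ` U) \<phi> \<psi>"
proof -
  have "\<forall>(U, \<phi>)\<in>A. open U \<and> open (\<phi> ` U) \<and> (\<exists>\<psi>. homeomorphism U (\<phi> ` U) \<phi> \<psi>)"
    using atlas unfolding holomorphic_atlas_def by (elim conjE)
  from bspec[OF this chart]
  show "open U" "open (\<phi> ` U)" "\<exists>\<psi>. homeomorphism U (\<phi> ` U) \<phi> \<psi>" by simp_all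
qed

lemma continuous_on_chart: "continuous_on U \<phi>"
  using chart_homeomorphism unfolding homeomorphism_def by blast

lemma inj_on_chart: "inj_on \<phi> U"
proof -
  obtain \<psi> where "homeomorphism U (\<phi> ` U) \<phi> \<psi>" using chart_homeomorphism by blast
  then have "\<psi> (\<phi> p) = p" if "p \<in> U" for p using that by (simp add: homeomorphism_def)
  then show ?thesis by (rule inj_on_inverseI)
qed

lemma inv_into_chart: "p \<in> U \<Longrightarrow> inv_into U \<phi> (\<phi> p) = p"
  by (simp add: inj_on_chart)

lemma open_chart_image_subset:
  assumes "open V" "V \<subseteq> U"
  shows "open (\<phi> ` V)"
proof -
  obtain \<psi> where "homeomorphism U (\<phi> ` U) \<phi> \<psi>" using chart_homeomorphism by blast
  moreover have "openin (top_of_set U) V" using assms by (simp add: openin_open_eq open_chart_domain)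
  ultimately have "openin (top_of_set (\<phi> ` U)) (\<phi> ` V)" by (rule homeomorphism_imp_open_map)
  then show ?thesis by (simp add: openin_open_eq open_chart_image)
qed

text \<open>Brings continuity back to the manifold for functions whose regularity is stated in
  coordinates, such as holomorphic functions and local metrics.\<close>

lemma continuous_on_in_chart:
  assumes "continuous_on (\<phi> ` (U \<inter> S)) (\<lambda>z. f (inv_into U \<phi> z))"
  shows "continuous_on (U \<inter> S) f"
proof -
  have "continuous_on (U \<inter> S) (\<lambda>p. f (inv_into U \<phi> (\<phi> p)))"
    using assms continuous_on_subset[OF continuous_on_chart]
    by (intro continuous_on_compose2[OF assms]) auto
  then show ?thesis by (rule continuous_on_eq) (simp add: inv_into_chart)
qed

end

lemma holomorphic_fun_on_imp_continuous_on:
  assumes "holomorphic_fun_on A S f" "open S"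
  shows "continuous_on S f"
proof -
  have "isCont f p" if "p \<in> S" for p
  proof -
    obtain U \<phi> where U: "(U, \<phi>) \<in> A" "p \<in> U" by (rule chart_at)
    have "holomorphic_Cn (\<phi> ` (U \<inter> S)) (\<lambda>z. f (inv_into U \<phi> z))"
      using assms U unfolding holomorphic_fun_on_def by blast
    then have "continuous_on (U \<inter> S) f"
      by (intro continuous_on_in_chart[OF U(1)] holomorphic_Cn_imp_continuous_on)
    then show ?thesis
      using U that assms(2) open_chart_domain[OF U(1)] by (auto simp: continuous_on_eq_continuous_at open_Int)
  qed
  then show ?thesis by (simp add: continuous_at_imp_continuous_on)
qed

lemma holomorphic_fun_on_linear_combination:
  assumes "open S" "\<And>t. t \<in> B \<Longrightarrow> holomorphic_fun_on A S (f t)"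
  shows "holomorphic_fun_on A S (\<lambda>p. \<Sum>t\<in>B. c t * f t p)"
  unfolding holomorphic_fun_on_def
proof clarify
  fix U \<phi> assume U: "(U, \<phi>) \<in> A"
  show "holomorphic_Cn (\<phi> ` (U \<inter> S)) (\<lambda>z. \<Sum>t\<in>B. c t * f t (inv_into U \<phi> z))"
    using U assms open_chart_domain[OF U]
    by (intro holomorphic_Cn_sum holomorphic_Cn_cmult open_chart_image_subset)
      (auto simp: holomorphic_fun_on_def open_Int)
qed

lemma holomorphic_fun_on_cong:
  assumes "holomorphic_fun_on A S f" "\<And>p. p \<in> S \<Longrightarrow> f p = g p"
  shows "holomorphic_fun_on A S g"
  unfolding holomorphic_fun_on_def
proof clarify
  fix U \<phi> assume U: "(U, \<phi>) \<in> A"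
  then have "holomorphic_Cn (\<phi> ` (U \<inter> S)) (\<lambda>z. f (inv_into U \<phi> z))"
    using assms by (auto simp: holomorphic_fun_on_def)
  then show "holomorphic_Cn (\<phi> ` (U \<inter> S)) (\<lambda>z. g (inv_into U \<phi> z))"
    by (rule holomorphic_Cn_cong) (auto simp: inv_into_chart[OF U] assms(2))
qed

end

section \<open>The Liouville measure of a compact Kaehler manifold\<close>

locale liouville_manifold = holomorphic_manifold A
  for A :: "('m::t2_space, 'n::finite) chart set" +
  fixes om :: "('m, 'n) two_form" and vol :: "'m measure"
  assumes compact: "compact (UNIV :: 'm set)"
    and kaehler: "kaehler_form A om"
    and liouville: "liouville_measure A om vol"
begin

lemma sets_vol [measurable_cong, simp]: "sets vol = sets borel"
  using liouville by (simp add: liouville_measure_def)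

lemma space_vol [simp]: "space vol = UNIV"
  using sets_eq_imp_space_eq[OF sets_vol] by simp

lemma emeasure_vol:
  assumes "(U, \<phi>) \<in> A" "B \<in> sets borel" "B \<subseteq> U"
  shows "emeasure vol B =
    (\<integral>\<^sup>+z. ennreal (liouville_density (om (U, \<phi>) z)) * indicator (\<phi> ` B) z \<partial>lborel)"
  using liouville assms unfolding liouville_measure_def by blast

text \<open>The density is a polynomial in the values of \<open>om\<close> on constant vectors, each
  of which is smooth in the coordinates.\<close>

lemma continuous_on_liouville_density:
  assumes "(U, \<phi>) \<in> A"
  shows "continuous_on (\<phi> ` U) (\<lambda>z. liouville_density (om (U, \<phi>) z))"
proof -
  have "smooth_on_open (\<phi> ` U) (\<lambda>z. om (U, \<phi>) z v w)" for v w
    using kaehler assms unfolding kaehler_form_def smooth_two_form_def by blast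
  then have "Ck_on 0 (\<phi> ` U) (\<lambda>z. om (U, \<phi>) z v w)" for v w
    unfolding smooth_on_open_def by blast
  then have "continuous_on (\<phi> ` U) (\<lambda>z. om (U, \<phi>) z v w)" for v w
    by simp
  then show ?thesis
    unfolding liouville_density_def by (intro continuous_intros)
qed

lemma liouville_density_om_pos:
  assumes "(U, \<phi>) \<in> A" "z \<in> \<phi> ` U"
  shows "liouville_density (om (U, \<phi>) z) > 0"
  using kaehler assms unfolding kaehler_form_def smooth_two_form_def
  by (intro liouville_density_pos) (auto simp: positive_11_form_def)

text \<open>A continuous density is bounded on a compact coordinate ball, which has finite Lebesgue
  measure.\<close>

lemma emeasure_vol_locally_finite:
  obtains N where "open N" "p \<in> N" "emeasure vol N < \<infinity>"
proof -
  obtain U \<phi> where U: "(U, \<phi>) \<in> A" "p \<in> U" by (rule chart_at)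
  let ?d = "\<lambda>z. liouville_density (om (U, \<phi>) z)"
  obtain r where r: "r > 0" "cball (\<phi> p) r \<subseteq> \<phi> ` U"
    using open_chart_image[OF U(1)] U(2) by (meson imageI open_contains_cball)
  \<comment> \<open>The bound lives on the closed ball, for compactness; the neighbourhood comes
    from the open one.\<close>
  define N where "N = \<phi> -` ball (\<phi> p) r \<inter> U"
  have N: "open N" "N \<subseteq> U" "p \<in> N"
    using continuous_on_chart[OF U(1)] open_chart_domain[OF U(1)] r(1) U(2)
    by (auto simp: N_def continuous_on_open_vimage)
  have "compact (?d ` cball (\<phi> p) r)"
    using continuous_on_subset[OF continuous_on_liouville_density[OF U(1)] r(2)]
    by (intro compact_continuous_image) auto
  then obtain K where K: "\<And>z. z \<in> cball (\<phi> p) r \<Longrightarrow> ?d z \<le> K"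
    by (meson bounded_imp_bdd_above compact_imp_bounded bdd_above.E imageI)
  have "emeasure vol N = (\<integral>\<^sup>+z. ennreal (?d z) * indicator (\<phi> ` N) z \<partial>lborel)"
    using N by (intro emeasure_vol U(1)) auto
  also have "\<dots> \<le> (\<integral>\<^sup>+z. ennreal K * indicator (cball (\<phi> p) r) z \<partial>lborel)"
  proof (rule nn_integral_mono)
    fix z :: "complex^'n"
    have "z \<in> cball (\<phi> p) r" if "z \<in> \<phi> ` N" using that by (auto simp: N_def)
    then show "ennreal (?d z) * indicator (\<phi> ` N) z \<le> ennreal K * indicator (cball (\<phi> p) r) z"
      using K[of z] by (auto split: split_indicator intro: ennreal_leI)
  qed
  also have "\<dots> = ennreal K * emeasure lborel (cball (\<phi> p) r)"
    by (simp add: nn_integral_cmult_indicator)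
  also have "\<dots> < \<infinity>"
    using emeasure_compact_finite[OF compact_cball[of "\<phi> p" r]] by (simp add: ennreal_mult_less_top)
  finally show ?thesis using N that by blast
qed

text \<open>Finitely many neighbourhoods of finite volume cover the compact manifold. Finiteness
  makes continuous functions integrable, so that the integrals below are not the default value
  0.\<close>

sublocale finite_measure vol
proof
  have "\<exists>N. open N \<and> p \<in> N \<and> emeasure vol N < \<infinity>" for p
    by (rule emeasure_vol_locally_finite[of p]) blast
  then obtain N where N: "\<And>p. open (N p)" "\<And>p. p \<in> N p" "\<And>p. emeasure vol (N p) < \<infinity>"
    by metis
  have "UNIV \<subseteq> (\<Union>p\<in>UNIV. N p)" using N(2) by blast
  with N(1) obtain D where D: "finite D" "UNIV \<subseteq> (\<Union>p\<in>D. N p)"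
    by (rule compactE_image[OF compact])
  have "(\<Union>p\<in>D. N p) = UNIV" using D(2) by blast
  then have "emeasure vol UNIV = emeasure vol (\<Union>p\<in>D. N p)" by (simp only:)
  also have "\<dots> \<le> (\<Sum>p\<in>D. emeasure vol (N p))"
    using N(1) D(1) by (intro emeasure_subadditive_finite) auto
  also have "\<dots> < \<infinity>" using N(3) D(1) by simp
  finally show "emeasure vol (space vol) \<noteq> \<infinity>" by simp
qed

text \<open>Inside a chart the density is strictly positive, so volume zero would make a nonempty
  open coordinate set Lebesgue null.\<close>

lemma emeasure_vol_open_pos:
  assumes "open V" "V \<noteq> {}"
  shows "emeasure vol V > 0"
proof -
  obtain p where p: "p \<in> V" using assms by blast
  obtain U \<phi> where U: "(U, \<phi>) \<in> A" "p \<in> U" by (rule chart_at)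
  let ?d = "\<lambda>z. liouville_density (om (U, \<phi>) z)"
  let ?S = "\<phi> ` (U \<inter> V)"
  have UV: "open (U \<inter> V)"
    using assms(1) open_chart_domain[OF U(1)] by (rule open_Int[rotated])
  have S: "open ?S" "?S \<noteq> {}"
    using open_chart_image_subset[OF U(1) UV] p U(2) by blast+
  \<comment> \<open>The density is controlled on the chart image only, so measurability is obtained
    for its product with the indicator.\<close>
  have meas: "(\<lambda>z. ennreal (?d z) * indicator ?S z) \<in> borel_measurable lborel"
  proof -
    have "continuous_on ?S ?d"
      by (rule continuous_on_subset[OF continuous_on_liouville_density[OF U(1)]]) auto
    then have "(\<lambda>z. indicator ?S z *\<^sub>R ?d z) \<in> borel_measurable borel"
      using S(1) by (intro borel_measurable_continuous_on_indicator) auto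
    then have "(\<lambda>z. ennreal (indicator ?S z *\<^sub>R ?d z)) \<in> borel_measurable borel" by simp
    also have "(\<lambda>z. ennreal (indicator ?S z *\<^sub>R ?d z)) = (\<lambda>z. ennreal (?d z) * indicator ?S z)"
      by (auto split: split_indicator)
    finally show ?thesis by simp
  qed
  have "emeasure vol (U \<inter> V) \<noteq> 0"
  proof
    assume "emeasure vol (U \<inter> V) = 0"
    then have "(\<integral>\<^sup>+z. ennreal (?d z) * indicator ?S z \<partial>lborel) = 0"
      using emeasure_vol[OF U(1), of "U \<inter> V"] assms(1) open_chart_domain[OF U(1)] by (simp add: open_Int)
    then have "AE z in lborel. ennreal (?d z) * indicator ?S z = 0"
      using nn_integral_0_iff_AE[OF meas] by simp
    moreover have "ennreal (?d z) * indicator ?S z = 0 \<longleftrightarrow> z \<notin> ?S" for z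
      using liouville_density_om_pos[OF U(1), of z] by (auto split: split_indicator)
    ultimately have "AE z in lborel. z \<notin> ?S" by simp
    then have "?S \<in> null_sets lborel"
      using S(1) by (subst AE_iff_null_sets) auto
    then have "negligible ?S"
      unfolding negligible_iff_null_sets by (rule null_sets_completionI)
    then show False
      using S open_not_negligible by blast
  qed
  moreover have "emeasure vol (U \<inter> V) \<le> emeasure vol V"
    using assms(1) by (intro emeasure_mono) auto
  ultimately show ?thesis by (simp add: zero_less_iff_neq_zero) (metis le_zero_eq)
qed

lemma integrable_continuous:
  fixes f :: "'m \<Rightarrow> 'b::{banach, second_countable_topology}"
  assumes "continuous_on UNIV f"
  shows "integrable vol f"
proof -
  have "bounded (range f)"
    using assms compact by (intro compact_imp_bounded compact_continuous_image)
  then obtain K where "\<And>p. norm (f p) \<le> K" by (auto simp: bounded_iff)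
  moreover have "f \<in> borel_measurable vol"
    using borel_measurable_continuous_onI[OF assms] measurable_cong_sets[OF sets_vol] by blast
  ultimately show ?thesis by (intro integrable_const_bound[of f K]) auto
qed

text \<open>The set where \<open>f\<close> is positive is open and null, hence empty. This turns
  vanishing almost everywhere into vanishing at each point.\<close>

lemma integral_nonneg_eq_0_imp:
  fixes f :: "'m \<Rightarrow> real"
  assumes "continuous_on UNIV f" "\<And>p. f p \<ge> 0" "integral\<^sup>L vol f = 0"
  shows "f p = 0"
proof (rule ccontr)
  assume "f p \<noteq> 0"
  let ?V = "{p. f p > 0}"
  have "AE p in vol. f p = 0"
    using assms integral_nonneg_eq_0_iff_AE[OF integrable_continuous] by simp
  then have "AE p in vol. p \<notin> ?V" by eventually_elim simp
  moreover have V: "open ?V" using assms(1) by (intro open_Collect_less) auto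
  ultimately have "?V \<in> null_sets vol"
    by (subst AE_iff_null_sets) auto
  moreover have "emeasure vol ?V > 0"
    using V assms(2)[of p] \<open>f p \<noteq> 0\<close> by (intro emeasure_vol_open_pos) (auto intro!: exI[of _ p])
  ultimately show False by auto
qed

end

section \<open>Sections of a hermitian line bundle\<close>

text \<open>For the Gram matrix of a basis this is the Riesz representation of the linear form with
  values \<open>b\<close>. The absence of nonzero isotropic vectors passes to subsets of
  \<open>B\<close>, which allows induction.\<close>

lemma hermitian_system_solvable:
  fixes G :: "'b \<Rightarrow> 'b \<Rightarrow> complex"
  assumes "finite B"
    and "\<And>d. (\<Sum>t\<in>B. \<Sum>u\<in>B. cnj (d t) * d u * G t u) = 0 \<Longrightarrow> \<forall>t\<in>B. d t = 0"
  shows "\<exists>c. \<forall>u\<in>B. (\<Sum>t\<in>B. cnj (c t) * G t u) = b u"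
  using assms
proof (induction B arbitrary: b)
  case empty
  then show ?case by simp
next
  case (insert x B)
  have "\<forall>t\<in>B. d t = 0" if "(\<Sum>t\<in>B. \<Sum>u\<in>B. cnj (d t) * d u * G t u) = 0" for d
  proof -
    \<comment> \<open>Extension by zero keeps the value of the form, so the hypothesis for the
      larger set applies.\<close>
    let ?d = "d(x := 0)"
    have "(\<Sum>t\<in>B. \<Sum>u\<in>B. cnj (?d t) * ?d u * G t u) = (\<Sum>t\<in>B. \<Sum>u\<in>B. cnj (d t) * d u * G t u)"
      using insert.hyps by (intro sum.cong) auto
    then have "(\<Sum>t\<in>insert x B. \<Sum>u\<in>insert x B. cnj (?d t) * ?d u * G t u) = 0"
      using insert.hyps that by simp
    then have "\<forall>t\<in>insert x B. ?d t = 0" by (rule insert.prems)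
    moreover have "t \<noteq> x" if "t \<in> B" for t using that insert.hyps by blast
    ultimately show ?thesis by simp
  qed
  note IH = insert.IH[OF this]
  obtain c where c: "\<And>u. u \<in> B \<Longrightarrow> (\<Sum>t\<in>B. cnj (c t) * G t u) = G x u"
    using IH[of "G x"] by blast
  obtain c' where c': "\<And>u. u \<in> B \<Longrightarrow> (\<Sum>t\<in>B. cnj (c' t) * G t u) = b u"
    using IH[of b] by blast
  \<comment> \<open>Gram--Schmidt: \<open>w\<close> is the component of the new vector orthogonal to the span of \<open>B\<close>.\<close>
  define w where "w = (\<lambda>t. - c t)(x := 1)"
  define W where "W u = (\<Sum>t\<in>insert x B. cnj (w t) * G t u)" for u
  have W: "W u = G x u - (\<Sum>t\<in>B. cnj (c t) * G t u)" for u
  proof -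
    have "(\<Sum>t\<in>B. cnj (w t) * G t u) = (\<Sum>t\<in>B. - (cnj (c t) * G t u))"
      using insert.hyps by (intro sum.cong) (auto simp: w_def)
    then show ?thesis using insert.hyps by (simp add: W_def w_def sum_negf)
  qed
  have W_B: "W u = 0" if "u \<in> B" for u using c[OF that] by (simp add: W)
  have "(\<Sum>t\<in>insert x B. \<Sum>u\<in>insert x B. cnj (w t) * w u * G t u) = (\<Sum>u\<in>insert x B. w u * W u)"
    unfolding W_def sum_distrib_left by (subst sum.swap) (simp only: mult_ac)
  also have "\<dots> = W x" using insert.hyps W_B by (simp add: w_def)
  \<comment> \<open>\<open>W x\<close> is the value of the form at \<open>w\<close>, and
    \<open>w\<close> is nonzero because its coefficient at \<open>x\<close> is 1.\<close>
  finally have "W x \<noteq> 0" using insert.prems[of w] by (auto simp: w_def)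
  \<comment> \<open>Adding a multiple of \<open>w\<close> leaves the equations on \<open>B\<close>
    intact, since \<open>W\<close> vanishes there; \<open>l\<close> is the multiple that settles the
    equation at \<open>x\<close>.\<close>
  define l where "l = (b x - (\<Sum>t\<in>B. cnj (c' t) * G t x)) / W x"
  define e where "e t = (if t = x then 0 else c' t) + cnj l * w t" for t
  have "(\<Sum>t\<in>insert x B. cnj (e t) * G t u) = (\<Sum>t\<in>B. cnj (c' t) * G t u) + l * W u" for u
  proof -
    have "(\<Sum>t\<in>insert x B. cnj (e t) * G t u) =
        (\<Sum>t\<in>insert x B. cnj (if t = x then 0 else c' t) * G t u) + l * W u"
      unfolding W_def sum_distrib_left e_def by (simp add: sum.distrib algebra_simps)
    also have "(\<Sum>t\<in>insert x B. cnj (if t = x then 0 else c' t) * G t u) = (\<Sum>t\<in>B. cnj (c' t) * G t u)"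
      using insert.hyps by (auto intro!: sum.cong)
    finally show ?thesis .
  qed
  then have "\<forall>u\<in>insert x B. (\<Sum>t\<in>insert x B. cnj (e t) * G t u) = b u"
    using c' W_B \<open>W x \<noteq> 0\<close> by (auto simp: l_def)
  then show ?case by blast
qed

section \<open>Fibre coordinates, metric and sections of the line bundle\<close>

locale hermitian_line_bundle = liouville_manifold A om vol
  for A :: "('m::t2_space, 'n::finite) chart set" and om :: "('m, 'n) two_form"
    and vol :: "'m measure" +
  fixes L :: "('m, 'l::topological_space) line_bundle" and h :: "'l \<Rightarrow> 'l \<Rightarrow> complex"
  assumes is_bundle: "holomorphic_line_bundle A L"
    and metric: "hermitian_metric A L h"
begin

lemma proj_fzero [simp]: "proj L (fzero L p) = p"
  and proj_fscale [simp]: "proj L (fscale L c q) = proj L q"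
  using is_bundle unfolding holomorphic_line_bundle_def by simp_all

lemma triv_at:
  obtains W \<tau> where "(W, \<tau>) \<in> triv L" "p \<in> W"
proof -
  have "(\<Union>(W, \<tau>)\<in>triv L. W) = UNIV"
    using is_bundle unfolding holomorphic_line_bundle_def by (elim conjE)
  then have "p \<in> (\<Union>(W, \<tau>)\<in>triv L. W)" by simp
  then show ?thesis using that by blast
qed

lemma transition:
  assumes "(W, \<tau>) \<in> triv L" "(W', \<tau>') \<in> triv L"
  obtains g where "\<And>p. p \<in> W \<inter> W' \<Longrightarrow> g p \<noteq> 0"
    "\<And>q. proj L q \<in> W \<inter> W' \<Longrightarrow> \<tau>' q = g (proj L q) * \<tau> q"
proof -
  have "\<forall>(W, \<tau>)\<in>triv L. \<forall>(W', \<tau>')\<in>triv L. \<exists>g.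
        holomorphic_fun_on A (W \<inter> W') g \<and>
        (\<forall>p\<in>W \<inter> W'. g p \<noteq> 0) \<and>
        (\<forall>q. proj L q \<in> W \<inter> W' \<longrightarrow> \<tau>' q = g (proj L q) * \<tau> q)"
    using is_bundle unfolding holomorphic_line_bundle_def by (elim conjE)
  from bspec[OF this assms(1), simplified case_prod_conv] 
  have "\<forall>(W', \<tau>')\<in>triv L. \<exists>g.
        holomorphic_fun_on A (W \<inter> W') g \<and>
        (\<forall>p\<in>W \<inter> W'. g p \<noteq> 0) \<and>
        (\<forall>q. proj L q \<in> W \<inter> W' \<longrightarrow> \<tau>' q = g (proj L q) * \<tau> q)" .
  from bspec[OF this assms(2), simplified case_prod_conv]
  obtain g where "\<forall>p\<in>W \<inter> W'. g p \<noteq> 0"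
    "\<forall>q. proj L q \<in> W \<inter> W' \<longrightarrow> \<tau>' q = g (proj L q) * \<tau> q" by (elim exE conjE)
  then show ?thesis by (intro that[of g]) blast+
qed

lemma metric_fscale: "proj L q' = proj L q \<Longrightarrow> h q (fscale L c q') = c * h q q'"
  and metric_cnj: "proj L q' = proj L q \<Longrightarrow> h q' q = cnj (h q q')"
  and metric_pos: "q \<noteq> fzero L (proj L q) \<Longrightarrow> Re (h q q) > 0"
  using metric unfolding hermitian_metric_def by blast+

context
  fixes W :: "'m set" and \<tau> :: "'l \<Rightarrow> complex"
  assumes triv: "(W, \<tau>) \<in> triv L"
begin

lemma open_triv: "open W"
  and triv_homeomorphism: "\<exists>g. homeomorphism (proj L -` W) (W \<times> UNIV) (\<lambda>q. (proj L q, \<tau> q)) g"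
  and triv_fzero: "p \<in> W \<Longrightarrow> \<tau> (fzero L p) = 0"
  and triv_fscale: "proj L q \<in> W \<Longrightarrow> \<tau> (fscale L c q) = c * \<tau> q"
proof -
  have "\<forall>(W, \<tau>)\<in>triv L.
        open W \<and>
        (\<exists>g. homeomorphism (proj L -` W) (W \<times> UNIV) (\<lambda>q. (proj L q, \<tau> q)) g) \<and>
        (\<forall>p\<in>W. \<tau> (fzero L p) = 0) \<and>
        (\<forall>q q'. proj L q \<in> W \<and> proj L q = proj L q' \<longrightarrow> \<tau> (fadd L q q') = \<tau> q + \<tau> q') \<and>
        (\<forall>c q. proj L q \<in> W \<longrightarrow> \<tau> (fscale L c q) = c * \<tau> q)"
    using is_bundle unfolding holomorphic_line_bundle_def by (elim conjE)
  from bspec[OF this triv, simplified case_prod_conv]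
  show "open W" "\<exists>g. homeomorphism (proj L -` W) (W \<times> UNIV) (\<lambda>q. (proj L q, \<tau> q)) g"
    "p \<in> W \<Longrightarrow> \<tau> (fzero L p) = 0" "proj L q \<in> W \<Longrightarrow> \<tau> (fscale L c q) = c * \<tau> q"
    by simp_all
qed

lemma triv_eqI:
  assumes "proj L q \<in> W" "proj L q' = proj L q" "\<tau> q' = \<tau> q"
  shows "q' = q"
proof -
  obtain g where g: "homeomorphism (proj L -` W) (W \<times> UNIV) (\<lambda>q. (proj L q, \<tau> q)) g"
    using triv_homeomorphism by (rule exE)
  have "g (proj L r, \<tau> r) = r" if "proj L r \<in> W" for r
    using homeomorphism_apply1[OF g, of r] that by simp
  then show ?thesis using assms by metis
qed

lemma triv_surj:
  assumes "p \<in> W"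
  obtains q where "proj L q = p" "\<tau> q = c"
proof -
  obtain g where g: "homeomorphism (proj L -` W) (W \<times> UNIV) (\<lambda>q. (proj L q, \<tau> q)) g"
    using triv_homeomorphism by (rule exE)
  have "(proj L (g (p, c)), \<tau> (g (p, c))) = (p, c)"
    using homeomorphism_apply2[OF g, of "(p, c)"] assms by simp
  then show ?thesis using that[of "g (p, c)"] by simp
qed

lemma triv_eq_0_iff: "proj L q \<in> W \<Longrightarrow> \<tau> q = 0 \<longleftrightarrow> q = fzero L (proj L q)"
  using triv_eqI[of q "fzero L (proj L q)"] triv_fzero[of "proj L q"] by auto

lemma triv_nonzero: "proj L q \<in> W \<Longrightarrow> q \<in> nonzero_vectors L \<longleftrightarrow> \<tau> q \<noteq> 0"
  by (simp add: nonzero_vectors_def triv_eq_0_iff)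

lemma local_frame:
  assumes "p \<in> W"
  shows proj_local_frame: "proj L (local_frame L \<tau> p) = p"
    and triv_local_frame: "\<tau> (local_frame L \<tau> p) = 1"
proof -
  obtain q where q: "proj L q = p" "\<tau> q = 1" using assms by (rule triv_surj)
  have "proj L (local_frame L \<tau> p) = p \<and> \<tau> (local_frame L \<tau> p) = 1"
    unfolding local_frame_def
  proof (rule theI)
    show "proj L q = p \<and> \<tau> q = 1" using q by simp
    show "q' = q" if "proj L q' = p \<and> \<tau> q' = 1" for q'
      using that q assms by (intro triv_eqI) auto
  qed
  then show "proj L (local_frame L \<tau> p) = p" "\<tau> (local_frame L \<tau> p) = 1" by simp_all
qed

text \<open>Fibres are one-dimensional, so the coefficient described by \<open>hat\<close> is a
  quotient of fibre coordinates; later computations with \<open>hat\<close> use this form.\<close>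

lemma hat_triv:
  assumes "q \<in> nonzero_vectors L" "proj L q \<in> W" "proj L (s (proj L q)) = proj L q"
  shows "hat L q s = \<tau> (s (proj L q)) / \<tau> q"
  unfolding hat_def
proof (rule the_equality)
  have nz: "\<tau> q \<noteq> 0" using assms triv_nonzero by simp
  show "s (proj L q) = fscale L (\<tau> (s (proj L q)) / \<tau> q) q"
    using assms nz by (intro triv_eqI) (simp_all add: triv_fscale)
  show "c = \<tau> (s (proj L q)) / \<tau> q" if "s (proj L q) = fscale L c q" for c
    using that assms nz by (simp add: triv_fscale)
qed

text \<open>Both vectors are multiples of the local frame. Taking the real part loses nothing, as
  hermitian symmetry makes the diagonal real, and it gives exactly the factor whose smoothness
  \<open>hermitian_metric\<close> provides.\<close>

lemma metric_triv:
  assumes "proj L q \<in> W" "proj L q' = proj L q"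
  shows "h q q' = cnj (\<tau> q) * \<tau> q' *
    of_real (Re (h (local_frame L \<tau> (proj L q)) (local_frame L \<tau> (proj L q))))"
proof -
  let ?s = "local_frame L \<tau> (proj L q)"
  have s: "proj L ?s = proj L q" "\<tau> ?s = 1" using local_frame assms(1) by simp_all
  have eq: "fscale L (\<tau> r) ?s = r" if "proj L r = proj L q" for r
    using that s assms(1) by (intro triv_eqI) (simp_all add: triv_fscale)
  have "h q q' = \<tau> q' * h q ?s"
    using metric_fscale[of ?s q "\<tau> q'"] s(1) eq[OF assms(2)] by simp
  also have "h q ?s = cnj (h ?s q)" using metric_cnj[of q ?s] s(1) by simp
  also have "h ?s q = \<tau> q * h ?s ?s"
    using metric_fscale[of ?s ?s "\<tau> q"] eq[OF refl] by simp
  also have "h ?s ?s = of_real (Re (h ?s ?s))"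
    using arg_cong[OF metric_cnj[OF refl], of Im] by (simp add: complex_eq_iff)
  finally show ?thesis by simp
qed

end

lemma nonzero_vector_over:
  obtains q where "q \<in> nonzero_vectors L" "proj L q = p"
proof -
  obtain W \<tau> where W: "(W, \<tau>) \<in> triv L" "p \<in> W" by (rule triv_at)
  obtain q where "proj L q = p" "\<tau> q = 1" using triv_surj[OF W] .
  then show ?thesis using that triv_nonzero[OF W(1), of q] W(2) by simp
qed

lemma metric_nonneg: "Re (h q q) \<ge> 0"
proof (cases "q = fzero L (proj L q)")
  case True
  obtain W \<tau> where W: "(W, \<tau>) \<in> triv L" "proj L q \<in> W" by (rule triv_at)
  have "\<tau> q = 0" using triv_eq_0_iff[OF W] True by simp
  then show ?thesis using metric_triv[OF W(1) W(2) refl] by simp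
next
  case False
  then show ?thesis using metric_pos by (simp add: less_imp_le)
qed

lemma hol_sectionsD:
  assumes "s \<in> hol_sections A L"
  shows "proj L (s p) = p" and "(W, \<tau>) \<in> triv L \<Longrightarrow> holomorphic_fun_on A W (\<lambda>p. \<tau> (s p))"
  using assms unfolding hol_sections_def by auto

lemma hat_eq_0_iff:
  assumes "s \<in> hol_sections A L" "q \<in> nonzero_vectors L"
  shows "hat L q s = 0 \<longleftrightarrow> s (proj L q) = fzero L (proj L q)"
proof -
  obtain W \<tau> where W: "(W, \<tau>) \<in> triv L" "proj L q \<in> W" by (rule triv_at)
  show ?thesis
    using hat_triv[OF W(1) assms(2) W(2), of s] hol_sectionsD(1)[OF assms(1)] triv_nonzero[OF W] assms(2)
      triv_eq_0_iff[OF W(1), of "s (proj L q)"] W(2) by simp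
qed

lemma section_eqI:
  assumes "s \<in> hol_sections A L" "t \<in> hol_sections A L"
    and "\<And>q. q \<in> nonzero_vectors L \<Longrightarrow> hat L q s = hat L q t"
  shows "s = t"
proof
  fix p
  obtain W \<tau> where W: "(W, \<tau>) \<in> triv L" "p \<in> W" by (rule triv_at)
  obtain q where q: "q \<in> nonzero_vectors L" "proj L q = p" by (rule nonzero_vector_over)
  have "\<tau> (s p) / \<tau> q = \<tau> (t p) / \<tau> q"
    using assms(3)[OF q(1)] hat_triv[OF W(1) q(1)] hol_sectionsD(1)[OF assms(1)]
      hol_sectionsD(1)[OF assms(2)] q(2) W(2) by simp
  moreover have "\<tau> q \<noteq> 0" using triv_nonzero[OF W(1), of q] q W(2) by simp
  ultimately have "\<tau> (s p) = \<tau> (t p)" by simp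
  then show "s p = t p"
    using W hol_sectionsD(1)[OF assms(1)] hol_sectionsD(1)[OF assms(2)]
    by (intro triv_eqI[OF W(1)]) simp_all
qed

text \<open>By \<open>metric_triv\<close> the function is locally a product of coordinates of the
  sections, continuous by holomorphy, and of the local metric, continuous by smoothness.\<close>

lemma continuous_on_metric_sections:
  assumes s: "s \<in> hol_sections A L" and t: "t \<in> hol_sections A L"
  shows "continuous_on UNIV (\<lambda>p. h (s p) (t p))"
proof -
  have "isCont (\<lambda>p. h (s p) (t p)) p" for p
  proof -
    obtain W \<tau> where W: "(W, \<tau>) \<in> triv L" "p \<in> W" by (rule triv_at)
    obtain U \<phi> where U: "(U, \<phi>) \<in> A" "p \<in> U" by (rule chart_at)
    let ?H = "\<lambda>p. Re (h (local_frame L \<tau> p) (local_frame L \<tau> p))"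
    have "\<forall>(U, \<phi>)\<in>A. \<forall>(W, \<tau>)\<in>triv L.
        smooth_on_open (\<phi> ` (U \<inter> W)) (local_metric L h (U, \<phi>) (W, \<tau>))"
      using metric unfolding hermitian_metric_def by (elim conjE)
    then have "smooth_on_open (\<phi> ` (U \<inter> W)) (local_metric L h (U, \<phi>) (W, \<tau>))"
      using U(1) W(1) by fast
    then have "Ck_on 0 (\<phi> ` (U \<inter> W)) (local_metric L h (U, \<phi>) (W, \<tau>))"
      unfolding smooth_on_open_def by blast
    then have "continuous_on (\<phi> ` (U \<inter> W)) (\<lambda>z. ?H (inv_into U \<phi> z))"
      by (simp add: local_metric_def Let_def)
    then have "continuous_on (U \<inter> W) ?H"
      by (rule continuous_on_in_chart[OF U(1)])
    moreover have "continuous_on (U \<inter> W) (\<lambda>p. \<tau> (r p))" if "r \<in> hol_sections A L" for r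
      using holomorphic_fun_on_imp_continuous_on[OF hol_sectionsD(2)[OF that W(1)] open_triv[OF W(1)]]
      by (rule continuous_on_subset) simp
    ultimately have "continuous_on (U \<inter> W) (\<lambda>p. cnj (\<tau> (s p)) * \<tau> (t p) * of_real (?H p))"
      using s t by (intro continuous_on_mult continuous_on_cnj continuous_on_of_real) blast+
    then have "continuous_on (U \<inter> W) (\<lambda>p. h (s p) (t p))"
      by (rule continuous_on_eq)
        (use metric_triv[OF W(1)] hol_sectionsD(1)[OF s] hol_sectionsD(1)[OF t] in simp)
    moreover have "open (U \<inter> W)"
      using open_chart_domain[OF U(1)] open_triv[OF W(1)] by (rule open_Int)
    ultimately show ?thesis
      using U(2) W(2) by (simp add: continuous_on_eq_continuous_at)
  qed
  then show ?thesis by (simp add: continuous_at_imp_continuous_on)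
qed

section \<open>The scalar product and linear combinations of sections\<close>

lemma section_inner_cnj:
  assumes "s \<in> hol_sections A L" "t \<in> hol_sections A L"
  shows "section_inner h vol t s = cnj (section_inner h vol s t)"
proof -
  have "section_inner h vol t s = (LINT p|vol. cnj (h (s p) (t p)))"
    unfolding section_inner_def
    by (simp add: metric_cnj[of "t _" "s _"] hol_sectionsD(1)[OF assms(1)] hol_sectionsD(1)[OF assms(2)])
  then show ?thesis by (simp add: section_inner_def)
qed

lemma section_inner_eq_0_imp:
  assumes s: "s \<in> hol_sections A L" and "section_inner h vol s s = 0"
  shows "s p = fzero L p"
proof (rule ccontr)
  assume nz: "s p \<noteq> fzero L p"
  have c: "continuous_on UNIV (\<lambda>p. h (s p) (s p))"
    using continuous_on_metric_sections[OF s s] .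
  have "(LINT p|vol. Re (h (s p) (s p))) = Re (section_inner h vol s s)"
    unfolding section_inner_def by (rule integral_Re[OF integrable_continuous[OF c]])
  also have "\<dots> = 0" using assms(2) by simp
  finally have "Re (h (s p) (s p)) = 0"
    by (rule integral_nonneg_eq_0_imp[OF continuous_on_Re[OF c] metric_nonneg])
  moreover have "Re (h (s p) (s p)) > 0"
    using nz hol_sectionsD(1)[OF s, of p] by (intro metric_pos) simp
  ultimately show False by simp
qed

text \<open>The section \<open>\<Sum>\<^sub>t c\<^sub>t t\<close>, glued from its expressions in the trivializations: a sum over a set
  of vectors in \<open>'l\<close> would need \<open>fadd\<close> to be associative and commutative on the whole type.\<close>

definition combination :: "('m \<Rightarrow> 'l) set \<Rightarrow> (('m \<Rightarrow> 'l) \<Rightarrow> complex) \<Rightarrow> 'm \<Rightarrow> 'l" where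
  "combination B c p =
     (THE r. proj L r = p \<and> (\<forall>(W, \<tau>)\<in>triv L. p \<in> W \<longrightarrow> \<tau> r = (\<Sum>t\<in>B. c t * \<tau> (t p))))"

text \<open>The vector is found in one trivialization at \<open>p\<close>. Passing to another
  multiplies its coordinate and those of all \<open>t p\<close> by the same number, so the linear
  relation persists.\<close>

lemma combination:
  assumes B: "B \<subseteq> hol_sections A L"
  shows proj_combination: "proj L (combination B c p) = p"
    and triv_combination: "(W, \<tau>) \<in> triv L \<Longrightarrow> p \<in> W \<Longrightarrow>
      \<tau> (combination B c p) = (\<Sum>t\<in>B. c t * \<tau> (t p))"
proof -
  let ?P = "\<lambda>r. proj L r = p \<and> (\<forall>(W, \<tau>)\<in>triv L. p \<in> W \<longrightarrow> \<tau> r = (\<Sum>t\<in>B. c t * \<tau> (t p)))"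
  obtain W0 \<tau>0 where W0: "(W0, \<tau>0) \<in> triv L" "p \<in> W0" by (rule triv_at)
  obtain r where r: "proj L r = p" "\<tau>0 r = (\<Sum>t\<in>B. c t * \<tau>0 (t p))" using triv_surj[OF W0] .
  have "\<tau> r = (\<Sum>t\<in>B. c t * \<tau> (t p))" if W: "(W, \<tau>) \<in> triv L" "p \<in> W" for W \<tau>
  proof -
    obtain g where g: "\<And>q. proj L q \<in> W0 \<inter> W \<Longrightarrow> \<tau> q = g (proj L q) * \<tau>0 q"
      using transition[OF W0(1) W(1)] by metis
    have "\<tau> r = g p * (\<Sum>t\<in>B. c t * \<tau>0 (t p))"
      using g[of r] r W0(2) W(2) by simp
    also have "\<dots> = (\<Sum>t\<in>B. c t * (g p * \<tau>0 (t p)))" by (simp add: sum_distrib_left mult_ac)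
    also have "\<dots> = (\<Sum>t\<in>B. c t * \<tau> (t p))"
    proof (rule sum.cong)
      fix t assume "t \<in> B"
      then have "proj L (t p) = p" using B hol_sectionsD(1) by blast
      then show "c t * (g p * \<tau>0 (t p)) = c t * \<tau> (t p)" using g[of "t p"] W0(2) W(2) by simp
    qed simp
    finally show ?thesis .
  qed
  then have "?P r" using r(1) by blast
  moreover have "r' = r" if "?P r'" for r'
  proof -
    have "proj L r' = p" "\<tau>0 r' = \<tau>0 r" using that W0 r by auto
    then show ?thesis using W0 r(1) by (intro triv_eqI[OF W0(1)]) simp_all
  qed
  ultimately have P: "?P (combination B c p)"
    unfolding combination_def by (rule theI)
  then show "proj L (combination B c p) = p" by simp
  show "\<tau> (combination B c p) = (\<Sum>t\<in>B. c t * \<tau> (t p))" if "(W, \<tau>) \<in> triv L" "p \<in> W"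
    using P that by blast
qed

lemma combination_hol_section:
  assumes "B \<subseteq> hol_sections A L"
  shows "combination B c \<in> hol_sections A L"
proof -
  have "holomorphic_fun_on A W (\<lambda>p. \<tau> (combination B c p))" if W: "(W, \<tau>) \<in> triv L" for W \<tau>
  proof (rule holomorphic_fun_on_cong)
    show "holomorphic_fun_on A W (\<lambda>p. \<Sum>t\<in>B. c t * \<tau> (t p))"
      using assms W open_triv[OF W] hol_sectionsD(2)
      by (intro holomorphic_fun_on_linear_combination) blast+
    show "(\<Sum>t\<in>B. c t * \<tau> (t p)) = \<tau> (combination B c p)" if "p \<in> W" for p
      using triv_combination[OF assms W that] by simp
  qed
  then show ?thesis
    unfolding hol_sections_def using proj_combination[OF assms] by blast
qed

lemma hat_combination:
  assumes B: "B \<subseteq> hol_sections A L" and q: "q \<in> nonzero_vectors L"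
  shows "hat L q (combination B c) = (\<Sum>t\<in>B. c t * hat L q t)"
proof -
  obtain W \<tau> where W: "(W, \<tau>) \<in> triv L" "proj L q \<in> W" by (rule triv_at)
  have "hat L q (combination B c) = (\<Sum>t\<in>B. c t * \<tau> (t (proj L q))) / \<tau> q"
    using hat_triv[OF W(1) q W(2), of "combination B c"] proj_combination[OF B]
      triv_combination[OF B W] by simp
  also have "\<dots> = (\<Sum>t\<in>B. c t * hat L q t)"
    unfolding sum_divide_distrib
  proof (rule sum.cong)
    fix t assume "t \<in> B"
    then have "proj L (t (proj L q)) = proj L q" using B hol_sectionsD(1) by blast
    then show "c t * \<tau> (t (proj L q)) / \<tau> q = c t * hat L q t"
      using hat_triv[OF W(1) q W(2), of t] by simp
  qed simp
  finally show ?thesis .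
qed

text \<open>Linearity is checked at each point in a trivialization and then integrated term by term,
  each term being continuous.\<close>

lemma section_inner_combination_right:
  assumes s: "s \<in> hol_sections A L" and B: "B \<subseteq> hol_sections A L"
  shows "section_inner h vol s (combination B c) = (\<Sum>t\<in>B. c t * section_inner h vol s t)"
proof -
  have "h (s p) (combination B c p) = (\<Sum>t\<in>B. c t * h (s p) (t p))" for p
  proof -
    obtain W \<tau> where W: "(W, \<tau>) \<in> triv L" "p \<in> W" by (rule triv_at)
    let ?H = "complex_of_real (Re (h (local_frame L \<tau> p) (local_frame L \<tau> p)))"
    have h: "h (s p) r = cnj (\<tau> (s p)) * \<tau> r * ?H" if "proj L r = p" for r
      using metric_triv[OF W(1), of "s p" r] hol_sectionsD(1)[OF s] W(2) that by simp
    have "h (s p) (combination B c p) = (\<Sum>t\<in>B. c t * (cnj (\<tau> (s p)) * \<tau> (t p) * ?H))"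
      unfolding h[OF proj_combination[OF B]] triv_combination[OF B W]
      by (simp add: sum_distrib_left sum_distrib_right mult_ac)
    also have "\<dots> = (\<Sum>t\<in>B. c t * h (s p) (t p))"
    proof (rule sum.cong)
      fix t assume "t \<in> B"
      then have "proj L (t p) = p" using B hol_sectionsD(1) by blast
      then show "c t * (cnj (\<tau> (s p)) * \<tau> (t p) * ?H) = c t * h (s p) (t p)" using h by simp
    qed simp
    finally show ?thesis .
  qed
  moreover have "integrable vol (\<lambda>p. c t * h (s p) (t p))" if "t \<in> B" for t
    using B that by (intro integrable_mult_right integrable_continuous continuous_on_metric_sections s) blast
  ultimately show ?thesis
    unfolding section_inner_def by (simp add: Bochner_Integration.integral_sum)
qed

lemma section_inner_combination_left:
  assumes s: "s \<in> hol_sections A L" and B: "B \<subseteq> hol_sections A L"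
  shows "section_inner h vol (combination B c) s = (\<Sum>t\<in>B. cnj (c t) * section_inner h vol t s)"
proof -
  have "section_inner h vol (combination B c) s = cnj (\<Sum>t\<in>B. c t * section_inner h vol s t)"
    using section_inner_cnj[OF s combination_hol_section[OF B]]
    by (simp add: section_inner_combination_right[OF s B])
  also have "\<dots> = (\<Sum>t\<in>B. cnj (c t) * cnj (section_inner h vol s t))" by simp
  also have "\<dots> = (\<Sum>t\<in>B. cnj (c t) * section_inner h vol t s)"
  proof (rule sum.cong)
    fix t assume "t \<in> B"
    then have "t \<in> hol_sections A L" using B by blast
    then show "cnj (c t) * cnj (section_inner h vol s t) = cnj (c t) * section_inner h vol t s"
      using section_inner_cnj[OF s, of t] by simp
  qed simp
  finally show ?thesis .
qed

section \<open>Riesz representation and coherent vectors\<close>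

lemma section_inner_left_cancel:
  assumes e: "e \<in> hol_sections A L" "e' \<in> hol_sections A L"
    and eq: "\<And>s. s \<in> hol_sections A L \<Longrightarrow> section_inner h vol e s = section_inner h vol e' s"
  shows "e = e'"
proof (rule ccontr)
  assume ne: "e \<noteq> e'"
  \<comment> \<open>The difference of the two sections. The assumption \<open>e \<noteq> e'\<close>
    matters: otherwise the index set would be a singleton and the coefficient -1 would be
    lost.\<close>
  define d where "d = combination {e, e'} (\<lambda>t. if t = e then 1 else -1)"
  have sub: "{e, e'} \<subseteq> hol_sections A L" using e by simp
  have d: "d \<in> hol_sections A L" unfolding d_def by (rule combination_hol_section[OF sub])
  have "section_inner h vol d d = section_inner h vol e d - section_inner h vol e' d"
    using section_inner_combination_left[OF d sub, of "\<lambda>t. if t = e then 1 else -1"] ne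
    by (simp flip: d_def)
  also have "\<dots> = 0" using eq[OF d] by simp
  finally have d0: "d p = fzero L p" for p by (rule section_inner_eq_0_imp[OF d])
  have "hat L q e = hat L q e'" if q: "q \<in> nonzero_vectors L" for q
  proof -
    have "hat L q d = 0" using hat_eq_0_iff[OF d q] d0 by simp
    then show ?thesis
      using hat_combination[OF sub q, of "\<lambda>t. if t = e then 1 else -1"] ne by (simp flip: d_def)
  qed
  then show False using section_eqI[OF e] ne by blast
qed

text \<open>Solving the Gram system represents the evaluation form on the basis, and linearity
  extends this to all sections. Uniqueness, by cancellation in the first slot, then unlocks the
  definite description.\<close>

lemma coherent_vector:
  assumes B: "section_basis A L B" and q: "q \<in> nonzero_vectors L"
  shows coherent_vector_hol_section: "coherent_vector A L h vol q \<in> hol_sections A L"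
    and section_inner_coherent_vector: "s \<in> hol_sections A L \<Longrightarrow>
      section_inner h vol (coherent_vector A L h vol q) s = hat L q s"
proof -
  have fin: "finite B" and sub: "B \<subseteq> hol_sections A L"
    and indep: "\<And>c. \<forall>q\<in>nonzero_vectors L. (\<Sum>t\<in>B. c t * hat L q t) = 0 \<Longrightarrow> \<forall>t\<in>B. c t = 0"
    and span: "\<And>s. s \<in> hol_sections A L \<Longrightarrow>
      \<exists>c. \<forall>q\<in>nonzero_vectors L. hat L q s = (\<Sum>t\<in>B. c t * hat L q t)"
    using B unfolding section_basis_def by simp_all
  have comb: "\<exists>c. s = combination B c" if s: "s \<in> hol_sections A L" for s
  proof -
    obtain c where "\<forall>q\<in>nonzero_vectors L. hat L q s = (\<Sum>t\<in>B. c t * hat L q t)"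
      using span[OF s] by (rule exE)
    then have "s = combination B c"
      by (intro section_eqI s combination_hol_section[OF sub]) (simp add: hat_combination[OF sub])
    then show ?thesis by blast
  qed
  \<comment> \<open>The double sum is the squared norm of the combination with coefficients
    \<open>d\<close>; if it is 0 the section vanishes and independence of the basis applies.\<close>
  have definite: "\<forall>t\<in>B. d t = 0"
    if d: "(\<Sum>t\<in>B. \<Sum>u\<in>B. cnj (d t) * d u * section_inner h vol t u) = 0" for d
  proof -
    let ?d = "combination B d"
    have d_hol: "?d \<in> hol_sections A L" by (rule combination_hol_section[OF sub])
    have "section_inner h vol ?d ?d = (\<Sum>t\<in>B. cnj (d t) * section_inner h vol t ?d)"
      by (rule section_inner_combination_left[OF d_hol sub])
    also have "\<dots> = (\<Sum>t\<in>B. \<Sum>u\<in>B. cnj (d t) * d u * section_inner h vol t u)"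
    proof (rule sum.cong)
      fix t assume "t \<in> B"
      then have "t \<in> hol_sections A L" using sub by blast
      then show "cnj (d t) * section_inner h vol t ?d =
          (\<Sum>u\<in>B. cnj (d t) * d u * section_inner h vol t u)"
        by (simp add: section_inner_combination_right[OF _ sub] sum_distrib_left mult_ac)
    qed simp
    finally have "?d p = fzero L p" for p using d section_inner_eq_0_imp[OF d_hol] by simp
    then have "\<forall>q\<in>nonzero_vectors L. (\<Sum>t\<in>B. d t * hat L q t) = 0"
      using hat_eq_0_iff[OF d_hol] hat_combination[OF sub] by simp
    then show ?thesis by (rule indep)
  qed
  obtain c where c: "\<And>u. u \<in> B \<Longrightarrow> (\<Sum>t\<in>B. cnj (c t) * section_inner h vol t u) = hat L q u"
    using hermitian_system_solvable[OF fin definite, where b = "hat L q"] by blast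
  let ?e = "combination B c"
  have e: "?e \<in> hol_sections A L" by (rule combination_hol_section[OF sub])
  have e_inner: "section_inner h vol ?e s = hat L q s" if s: "s \<in> hol_sections A L" for s
  proof -
    obtain a where a: "s = combination B a" using comb[OF s] by (rule exE)
    have "section_inner h vol ?e s = (\<Sum>u\<in>B. a u * section_inner h vol ?e u)"
      unfolding a by (rule section_inner_combination_right[OF e sub])
    also have "\<dots> = (\<Sum>u\<in>B. a u * hat L q u)"
    proof (rule sum.cong)
      fix u assume u: "u \<in> B"
      then have "u \<in> hol_sections A L" using sub by blast
      then show "a u * section_inner h vol ?e u = a u * hat L q u"
        using section_inner_combination_left[OF _ sub, of u c] c[OF u] by simp
    qed simp
    also have "\<dots> = hat L q s" unfolding a by (simp add: hat_combination[OF sub q])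
    finally show ?thesis .
  qed
  have "coherent_vector A L h vol q \<in> hol_sections A L \<and>
    (\<forall>s\<in>hol_sections A L. section_inner h vol (coherent_vector A L h vol q) s = hat L q s)"
    unfolding coherent_vector_def
  proof (rule theI[where a = ?e])
    show "?e \<in> hol_sections A L \<and> (\<forall>s\<in>hol_sections A L. section_inner h vol ?e s = hat L q s)"
      using e e_inner by simp
    show "e' = ?e" if "e' \<in> hol_sections A L \<and>
        (\<forall>s\<in>hol_sections A L. section_inner h vol e' s = hat L q s)" for e'
      using that e e_inner by (intro section_inner_left_cancel) simp_all
  qed
  then show "coherent_vector A L h vol q \<in> hol_sections A L"
    "s \<in> hol_sections A L \<Longrightarrow> section_inner h vol (coherent_vector A L h vol q) s = hat L q s"
    by simp_all
qed

text \<open>A vanishing coherent vector would make every section vanish at \<open>proj L q\<close>,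
  against the existence of a basis section that does not.\<close>

lemma nonzero_coherent_vector:
  assumes B: "section_basis A L B" "projective_embedding A L B" and q: "q \<in> nonzero_vectors L"
  shows "nonzero_section L (coherent_vector A L h vol q)"
proof (rule ccontr)
  let ?e = "coherent_vector A L h vol q"
  assume "\<not> nonzero_section L ?e"
  then have zero: "?e p = fzero L p" for p by (simp add: nonzero_section_def)
  have e: "?e \<in> hol_sections A L" by (rule coherent_vector_hol_section[OF B(1) q])
  obtain t where t: "t \<in> B" "t (proj L q) \<noteq> fzero L (proj L q)"
    using B(2) unfolding projective_embedding_def by blast
  have t_hol: "t \<in> hol_sections A L" using B(1) t(1) unfolding section_basis_def by blast
  \<comment> \<open>The empty combination stands for the zero section, so that linearity gives the
    value 0.\<close>
  have "section_inner h vol t ?e = section_inner h vol t (combination {} (\<lambda>_. 0))"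
  proof -
    have "?e = combination {} (\<lambda>_. 0)"
      using zero hat_eq_0_iff[OF e]
      by (intro section_eqI e combination_hol_section) (simp_all add: hat_combination)
    then show ?thesis by simp
  qed
  also have "\<dots> = 0" by (simp add: section_inner_combination_right[OF t_hol])
  finally have "section_inner h vol ?e t = 0"
    using section_inner_cnj[OF t_hol e] by simp
  then have "hat L q t = 0" using section_inner_coherent_vector[OF B(1) q t_hol] by simp
  then show False using hat_eq_0_iff[OF t_hol q] t(2) by simp
qed

text \<open>The scalar product of two coherent vectors vanishes exactly when either of them vanishes
  at the base point of the other. These conditions see the vectors \<open>q1\<close>,
  \<open>q2\<close> on the evaluation side only through their base points.\<close>

lemma polar_divisor_eq_reduced_support:
  assumes B: "section_basis A L B" and q: "q \<in> nonzero_vectors L"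
  shows "polar_divisor A L h vol (proj L q) = reduced_support L (coherent_vector A L h vol q)"
proof -
  let ?e = "coherent_vector A L h vol"
  have sym: "section_inner h vol (?e q1) (?e q2) = hat L q1 (?e q2)"
    "section_inner h vol (?e q1) (?e q2) = cnj (hat L q2 (?e q1))"
    if "q1 \<in> nonzero_vectors L" "q2 \<in> nonzero_vectors L" for q1 q2
    using that section_inner_coherent_vector[OF B] coherent_vector_hol_section[OF B]
      section_inner_cnj[of "?e q2" "?e q1"] by simp_all
  have zero_at: "section_inner h vol (?e q1) (?e q2) = 0 \<longleftrightarrow> ?e q2 (proj L q1) = fzero L (proj L q1)"
    "section_inner h vol (?e q1) (?e q2) = 0 \<longleftrightarrow> ?e q1 (proj L q2) = fzero L (proj L q2)"
    if q12: "q1 \<in> nonzero_vectors L" "q2 \<in> nonzero_vectors L" for q1 q2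
  proof -
    show "section_inner h vol (?e q1) (?e q2) = 0 \<longleftrightarrow> ?e q2 (proj L q1) = fzero L (proj L q1)"
      unfolding sym(1)[OF q12]
      by (rule hat_eq_0_iff[OF coherent_vector_hol_section[OF B q12(2)] q12(1)])
    show "section_inner h vol (?e q1) (?e q2) = 0 \<longleftrightarrow> ?e q1 (proj L q2) = fzero L (proj L q2)"
      unfolding sym(2)[OF q12] complex_cnj_zero_iff
      by (rule hat_eq_0_iff[OF coherent_vector_hol_section[OF B q12(1)] q12(2)])
  qed
  have "x' \<in> polar_divisor A L h vol (proj L q) \<longleftrightarrow> ?e q x' = fzero L x'" for x'
  proof
    obtain q' where q': "q' \<in> nonzero_vectors L" "proj L q' = x'" by (rule nonzero_vector_over)
    show "?e q x' = fzero L x'" if "x' \<in> polar_divisor A L h vol (proj L q)"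
      using that q q' zero_at(2)[OF q q'(1)] by (simp add: polar_divisor_def)
    assume 0: "?e q x' = fzero L x'"
    \<comment> \<open>From \<open>q\<close> to \<open>q1\<close>: vanishing of \<open>?e q\<close>
      at \<open>x'\<close> means that \<open>?e q2\<close> vanishes at the base point of
      \<open>q\<close>, which is also that of \<open>q1\<close>.\<close>
    have "section_inner h vol (?e q1) (?e q2) = 0"
      if q12: "q1 \<in> nonzero_vectors L" "q2 \<in> nonzero_vectors L" "proj L q1 = proj L q" "proj L q2 = x'"
      for q1 q2
      using zero_at(2)[OF q q12(2)] zero_at(1)[OF q q12(2)] zero_at(1)[OF q12(1,2)] q12(3,4) 0 by simp
    then show "x' \<in> polar_divisor A L h vol (proj L q)"
      by (simp add: polar_divisor_def)
  qed
  then show ?thesis by (auto simp: reduced_support_def)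
qed

end

theorem proposition3p2:
  fixes A :: "('m::t2_space, 'n::finite) chart set"
    and om :: "('m, 'n) two_form"
    and vol :: "'m measure"
    and L :: "('m, 'l::topological_space) line_bundle"
    and h :: "'l \<Rightarrow> 'l \<Rightarrow> complex"
    and x :: 'm
  assumes "compact (UNIV :: 'm set)" and "connected (UNIV :: 'm set)"
    and "holomorphic_atlas A"
    and "kaehler_form A om"
    and "liouville_measure A om vol"
    and "quantum_line_bundle A om L h"
    and "very_ample A L"
  shows "(\<exists>s\<in>hol_sections A L. nonzero_section L s \<and>
            polar_divisor A L h vol x = reduced_support L s) \<and>
         (\<forall>q. proj L q = x \<and> q \<noteq> fzero L x \<longrightarrow>
            coherent_vector A L h vol q \<in> hol_sections A L \<and>
            nonzero_section L (coherent_vector A L h vol q) \<and>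
            polar_divisor A L h vol x = reduced_support L (coherent_vector A L h vol q))"
proof -
  interpret hermitian_line_bundle A om vol L h
    using assms by unfold_locales (simp_all add: quantum_line_bundle_def)
  obtain B where B: "section_basis A L B" "projective_embedding A L B"
    using assms(7) unfolding very_ample_def by (elim exE conjE)
  have coherent: "coherent_vector A L h vol q \<in> hol_sections A L \<and>
      nonzero_section L (coherent_vector A L h vol q) \<and>
      polar_divisor A L h vol x = reduced_support L (coherent_vector A L h vol q)"
    if q: "proj L q = x" "q \<in> nonzero_vectors L" for q
    using coherent_vector_hol_section[OF B(1) q(2)] nonzero_coherent_vector[OF B q(2)]
      polar_divisor_eq_reduced_support[OF B(1) q(2)] q(1) by simp
  \<comment> \<open>A nonzero vector over \<open>x\<close> supplies the witness for the existential
    part.\<close>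
  obtain q where "q \<in> nonzero_vectors L" "proj L q = x" by (rule nonzero_vector_over)
  then show ?thesis
    using coherent by (auto simp: nonzero_vectors_def)
qed

end
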